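(* Let $\mathbf{X}$ be a stationary, irreducible and aperiodic first-order time-homogeneous Markov chain on a finite alphabet $\mathcal{X}$, let $\mathbb{W}$ be a row-stochastic matrix (conditional distribution) from $\mathcal{X}$ to a finite alphabet $\mathcal{Y}$, and let $\mathbf{Y}$ be the process obtained by observing $\mathbf{X}$ through $\mathbb{W}$. With $\mathcal{C}_L$, $\mathcal{C}_P$, $\mathcal{C}_\beta$ and $\delta_\beta$ as defined in the context, the following hold for $0\le\beta\le 1$: 1. $\mathcal{C}_\beta(\mathbf{X},\mathbb{W})\ge 0$. 2. $\delta_{0.5}(\mathbf{X},\mathbb{W})=\mathcal{C}_{0.5}(\mathbf{X},\mathbb{W})=\frac12\,\mathcal{C}_P(\mathbf{X},\mathbb{W})$. 3. $\mathcal{C}_1(\mathbf{X},\mathbb{W})=I(X_1;X_2|Y_2)$. 4. For $\beta\le\frac12$: $\ \beta\,\mathcal{C}_P(\mathbf{X},\mathbb{W})\le\delta_\beta(\mathbf{X},\mathbb{W})\le\mathcal{C}_\beta(\mathbf{X},\mathbb{W})$. 5. For $\beta\ge\frac12$: $\ \mathcal{C}_\beta(\mathbf{X},\mathbb{W})\le\delta_\beta(\mathbf{X},\mathbb{W})\le\beta\,\mathcal{C}_P(\mathbf{X},\mathbb{W})$. 6. If $\mathbf{X}$ is reversible, then $\mathcal{C}_\beta(\mathbf{X},\mathbb{W})$ is non-decreasing in $\beta$.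
   Context: $\mathbf{X}=(X_1,X_2,\dots)$ has transition matrix $\mathbb{P}=[P_{x\to x'}]$ and starts in its unique invariant distribution $\boldsymbol{\mu}$; it is reversible if $\mu_xP_{x\to x'}=\mu_{x'}P_{x'\to x}$ for all $x,x'\in\mathcal{X}$. Write $\mathbb{W}=[W_{x\to y}]$ with $W_{x\to y}=p_{Y|X}(y|x)$. The process $\mathbf{Y}=(Y_1,Y_2,\dots)$ obtained by observing $\mathbf{X}$ through $\mathbb{W}$ is the stationary hidden Markov process in which, given $\mathbf{X}$, the $Y_k$ are conditionally independent and $Y_k$ depends only on $X_k$, with $\Pr(Y_k=y|X_k=x)=W_{x\to y}$. $H(\cdot)$, $H(\cdot|\cdot)$, $I(\cdot;\cdot)$, $I(\cdot;\cdot|\cdot)$ are Shannon entropy, conditional entropy, mutual information and conditional mutual information. For a stationary process $\mathbf{Z}$ on a finite alphabet, the entropy rate is $\bar H(\mathbf{Z})=\lim_{n\to\infty}H(Z_n|Z_1,\dots,Z_{n-1})$ and the redundancy rate is $\bar R(\mathbf{Z})=\lim_{n\to\infty}I(Z_n;Z_1,\dots,Z_{n-1})=H(Z)-\bar H(\mathbf{Z})$, where $H(Z)$ is the entropy of the marginal distribution. The Kullback-Leibler divergence rate between stationary processes $\mathbf{Z}',\mathbf{Z}$ on the same finite alphabet $\mathcal{Z}$ is $$\bar D(\mathbf{Z}'\|\mathbf{Z})=\lim_{n\to\infty}\frac1n\sum_{z_1^n\in\mathcal{Z}^n}p_{{Z'}_1^n}(z_1^n)\log\frac{p_{{Z'}_1^n}(z_1^n)}{p_{Z_1^n}(z_1^n)}.$$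 $\tilde{\mathbf{Y}}$ denotes the Markov approximation of $\mathbf{Y}$: the stationary Markov chain on $\mathcal{Y}$ with marginal distribution $p_{Y}$ and transition probabilities $Q_{y\to y'}=p_{Y_2|Y_1}(y'|y)$ (rows for $y$ with $p_Y(y)=0$ are irrelevant). Cost functions: - $\mathcal{C}_L(\mathbf{X},\mathbb{W}):=H(Y_2|Y_1)-H(Y_2|X_1)$, - $\mathcal{C}_P(\mathbf{X},\mathbb{W}):=I(X_1;X_2)-I(Y_1;Y_2)$, - $\mathcal{C}_\beta(\mathbf{X},\mathbb{W}):=(1-2\beta)\,\mathcal{C}_L(\mathbf{X},\mathbb{W})+\beta\,\mathcal{C}_P(\mathbf{X},\mathbb{W})$ for $\beta\in[0,1]$, - $\delta_\beta(\mathbf{X},\mathbb{W}):=(1-\beta)\,\bar D(\mathbf{Y}\|\tilde{\mathbf{Y}})+\beta\,(\bar R(\mathbf{X})-\bar R(\mathbf{Y}))$ for $\beta\in[0,1]$. *)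

theory Defs
  imports "HOL-Probability.Information"
begin

text \<open>
  Finite alphabets are types of class \<open>finite\<close> and matrices are real-valued functions of the row
  and column index.  Processes are indexed from 0, so \<open>Z 0, Z 1, ...\<close> stand for
  $Z_1, Z_2, \dots$.
\<close>

section \<open>Stochastic matrices\<close>

definition row_stochastic :: "('a \<Rightarrow> 'b::finite \<Rightarrow> real) \<Rightarrow> bool" where
  "row_stochastic K \<longleftrightarrow> (\<forall>x. (\<forall>y. 0 \<le> K x y) \<and> (\<Sum>y\<in>UNIV. K x y) = 1)"

primrec mat_pow :: "('a::finite \<Rightarrow> 'a \<Rightarrow> real) \<Rightarrow> nat \<Rightarrow> 'a \<Rightarrow> 'a \<Rightarrow> real" where
  "mat_pow P 0 = (\<lambda>x x'. if x = x' then 1 else 0)"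
| "mat_pow P (Suc n) = (\<lambda>x x'. \<Sum>z\<in>UNIV. P x z * mat_pow P n z x')"

definition irreducible_matrix :: "('a::finite \<Rightarrow> 'a \<Rightarrow> real) \<Rightarrow> bool" where
  "irreducible_matrix P \<longleftrightarrow> (\<forall>x x'. \<exists>n. 0 < mat_pow P n x x')"

definition aperiodic_matrix :: "('a::finite \<Rightarrow> 'a \<Rightarrow> real) \<Rightarrow> bool" where
  "aperiodic_matrix P \<longleftrightarrow> (\<forall>x. Gcd {n. 0 < n \<and> 0 < mat_pow P n x x} = (1::nat))"

definition invariant_distribution :: "('a::finite \<Rightarrow> real) \<Rightarrow> ('a \<Rightarrow> 'a \<Rightarrow> real) \<Rightarrow> bool" where
  "invariant_distribution \<mu> P \<longleftrightarrow>
     (\<forall>x. 0 \<le> \<mu> x) \<and> (\<Sum>x\<in>UNIV. \<mu> x) = 1 \<and> (\<forall>x'. (\<Sum>x\<in>UNIV. \<mu> x * P x x') = \<mu> x')"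

definition reversible :: "('a \<Rightarrow> real) \<Rightarrow> ('a \<Rightarrow> 'a \<Rightarrow> real) \<Rightarrow> bool" where
  "reversible \<mu> P \<longleftrightarrow> (\<forall>x x'. \<mu> x * P x x' = \<mu> x' * P x' x)"

section \<open>Processes\<close>

definition (in prob_space) markov_chain ::
    "('b::finite \<Rightarrow> real) \<Rightarrow> ('b \<Rightarrow> 'b \<Rightarrow> real) \<Rightarrow> (nat \<Rightarrow> 'a \<Rightarrow> 'b) \<Rightarrow> bool" where
  "markov_chain \<mu> K Z \<longleftrightarrow>
     (\<forall>n. random_variable (count_space UNIV) (Z n)) \<and>
     (\<forall>z. \<P>(\<omega> in M. Z 0 \<omega> = z) = \<mu> z) \<and>
     (\<forall>n z. 0 < \<P>(\<omega> in M. \<forall>i\<le>n. Z i \<omega> = z i) \<longrightarrow>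
        \<P>(\<omega> in M. Z (Suc n) \<omega> = z (Suc n) \<bar> \<forall>i\<le>n. Z i \<omega> = z i) = K (z n) (z (Suc n)))"

text \<open>
  \<open>Y\<close> arises from \<open>X\<close> through the memoryless channel \<open>W\<close>.  Conditioning on the block
  \<open>X 0, ..., X n\<close> amounts to conditioning on the whole path: summing the identity for a longer
  block over the surplus \<open>y i\<close> gives the same product given any longer block of \<open>X\<close>.
\<close>

definition (in prob_space) observed_through ::
    "('x \<Rightarrow> 'y \<Rightarrow> real) \<Rightarrow> (nat \<Rightarrow> 'a \<Rightarrow> 'x::finite) \<Rightarrow> (nat \<Rightarrow> 'a \<Rightarrow> 'y::finite) \<Rightarrow> bool" where
  "observed_through W X Y \<longleftrightarrow>
     (\<forall>n. random_variable (count_space UNIV) (Y n)) \<and>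
     (\<forall>n x y. 0 < \<P>(\<omega> in M. \<forall>i\<le>n. X i \<omega> = x i) \<longrightarrow>
        \<P>(\<omega> in M. \<forall>i\<le>n. Y i \<omega> = y i \<bar> \<forall>i\<le>n. X i \<omega> = x i) = (\<Prod>i\<le>n. W (x i) (y i)))"

text \<open>
  The Markov approximation is a process in its own right and may live on another probability
  space \<open>N\<close>; only its law is used.
\<close>

definition markov_approximation ::
    "'w measure \<Rightarrow> (nat \<Rightarrow> 'w \<Rightarrow> 'y::finite) \<Rightarrow> 'v measure \<Rightarrow> (nat \<Rightarrow> 'v \<Rightarrow> 'y) \<Rightarrow> bool" where
  "markov_approximation M Y N Yt \<longleftrightarrow>
     prob_space.markov_chain N
       (\<lambda>y. \<P>(\<omega> in M. Y 0 \<omega> = y))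
       (\<lambda>y y'. \<P>(\<omega> in M. Y 1 \<omega> = y' \<bar> Y 0 \<omega> = y)) Yt"

definition block :: "(nat \<Rightarrow> 'w \<Rightarrow> 'z) \<Rightarrow> nat \<Rightarrow> 'w \<Rightarrow> 'z list" where
  "block Z n \<omega> = map (\<lambda>i. Z i \<omega>) [0..<n]"

section \<open>Information rates and cost functions\<close>

text \<open>
  The summands follow the convention $0 \log (0/q) = 0$ also for $q = 0$.  A word with
  $p' > 0 = p$ should contribute $\infty$ but contributes $0$ here; this never happens when
  \<open>Z\<close> is the Markov approximation of \<open>Z'\<close>, which gives positive probability to every word
  that has positive probability under a stationary \<open>Z'\<close>.
\<close>

definition kl_divergence_rate ::
    "real \<Rightarrow> 'w measure \<Rightarrow> (nat \<Rightarrow> 'w \<Rightarrow> 'z::finite) \<Rightarrow> 'v measure \<Rightarrow> (nat \<Rightarrow> 'v \<Rightarrow> 'z) \<Rightarrow> real" where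
  "kl_divergence_rate b M Z' N Z =
     lim (\<lambda>n. 1 / real n *
       (\<Sum>z\<in>{z. length z = n}.
          \<P>(\<omega> in M. block Z' n \<omega> = z) *
            log b (\<P>(\<omega> in M. block Z' n \<omega> = z) / \<P>(\<omega> in N. block Z n \<omega> = z))))"

context information_space
begin

definition redundancy_rate :: "(nat \<Rightarrow> 'a \<Rightarrow> 'z::finite) \<Rightarrow> real" where
  "redundancy_rate Z = lim (\<lambda>n. \<I>(Z n ; block Z n))"

definition cost_L :: "(nat \<Rightarrow> 'a \<Rightarrow> 'x::finite) \<Rightarrow> (nat \<Rightarrow> 'a \<Rightarrow> 'y::finite) \<Rightarrow> real" where
  "cost_L X Y = \<H>(Y 1 | Y 0) - \<H>(Y 1 | X 0)"

definition cost_P :: "(nat \<Rightarrow> 'a \<Rightarrow> 'x::finite) \<Rightarrow> (nat \<Rightarrow> 'a \<Rightarrow> 'y::finite) \<Rightarrow> real" where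
  "cost_P X Y = \<I>(X 0 ; X 1) - \<I>(Y 0 ; Y 1)"

definition cost :: "real \<Rightarrow> (nat \<Rightarrow> 'a \<Rightarrow> 'x::finite) \<Rightarrow> (nat \<Rightarrow> 'a \<Rightarrow> 'y::finite) \<Rightarrow> real" where
  "cost \<beta> X Y = (1 - 2 * \<beta>) * cost_L X Y + \<beta> * cost_P X Y"

definition delta ::
    "real \<Rightarrow> (nat \<Rightarrow> 'a \<Rightarrow> 'x::finite) \<Rightarrow> (nat \<Rightarrow> 'a \<Rightarrow> 'y::finite) \<Rightarrow>
      'v measure \<Rightarrow> (nat \<Rightarrow> 'v \<Rightarrow> 'y) \<Rightarrow> real" where
  "delta \<beta> X Y N Yt =
     (1 - \<beta>) * kl_divergence_rate b M Y N Yt + \<beta> * (redundancy_rate X - redundancy_rate Y)"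

end

end

theory Submission
  imports Defs
begin

text \<open>
  Write $h = \bar H(\mathbf{Y})$.  Since $\log p_{\tilde Y_1^n}$ is a sum of one-step terms and
  $\mathbf{Y}$ is stationary, $\bar D(\mathbf{Y}\,\Vert\,\tilde{\mathbf{Y}}) = H(Y_2|Y_1) - h =: D$, and
  $\bar R(\mathbf{X}) - \bar R(\mathbf{Y}) = \mathcal{C}_P - D$; hence
  $\delta_\beta = (1-2\beta) D + \beta\,\mathcal{C}_P$.  Conditioning bounds
  $H(Y_2|X_1) \le h \le H(Y_2|Y_1)$ say that $0 \le D \le \mathcal{C}_L$, which gives items 2, 4
  and 5.  As $\mathcal{C}_\beta$ is affine in $\beta$ with $\mathcal{C}_0 = \mathcal{C}_L$ and
  $\mathcal{C}_1 = \mathcal{C}_P - \mathcal{C}_L = I(X_1;X_2|Y_2)$, items 1 and 3 follow, and item 6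
  reduces to $\mathcal{C}_0 \le \mathcal{C}_1$.  Under reversibility
  $\mathcal{C}_L = I(Y_1;X_2|Y_2)$, so this is data processing.
\<close>

section \<open>Entropies of simple functions\<close>

text \<open>The device behind every estimate is to write each information quantity as a signed sum
  of joint entropies of finite-valued variables. A Markov property then becomes a vanishing
  conditional mutual information, that is, a linear equation between entropies. That conditioning
  lowers entropy becomes submodularity. What remains is linear arithmetic, once joint entropies of
  the same variables in different packings (tuples in another order, lists) are identified. The
  obstacle is that Y is in general not a Markov chain. The pair process of the (X_n, Y_n) is one,
  and its kernel does not depend on the observation of the state it leaves, so conditioning on X_n
  alone separates the past from the next pair. Stationarity and all conditional independences are
  read off this chain. The data processing step compares I(Y_1;X_2|Y_2) with I((X_1,Y_1);X_2|Y_2);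
  the latter equals I(X_1;X_2|Y_2), because given X_1 the observation Y_1 is independent of
  (X_2,Y_2).\<close>

lemma tendsto_arithmetic_mean:
  fixes d :: "nat \<Rightarrow> real"
  assumes "d \<longlonglongrightarrow> l"
  shows "(\<lambda>n. (\<Sum>i<n. d i) / real n) \<longlonglongrightarrow> l"
proof (rule LIMSEQ_I)
  fix r :: real assume r: "0 < r"
  obtain N where N: "norm (d i - l) < r / 2" if "N \<le> i" for i
    using LIMSEQ_D[OF assms, of "r / 2"] r by auto
  \<comment> \<open>\<open>C\<close> is the total error of the first \<open>N\<close> terms. It does
    not grow with \<open>n\<close>, so \<open>C / n\<close> falls below \<open>r / 2\<close>; every
    later term adds at most \<open>r / 2\<close> to the sum.\<close>
  define C where "C = (\<Sum>i<N. \<bar>d i - l\<bar>)"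
  have "(\<lambda>n. C / real n) \<longlonglongrightarrow> 0"
    by (rule lim_const_over_n)
  then obtain N' where N': "norm (C / real n - 0) < r / 2" if "N' \<le> n" for n
    using LIMSEQ_D[of "\<lambda>n. C / real n" 0 "r / 2"] r by auto
  show "\<exists>n0. \<forall>n\<ge>n0. norm ((\<Sum>i<n. d i) / real n - l) < r"
  proof (intro exI allI impI)
    fix n assume "max 1 (max N N') \<le> n"
    then have n: "1 \<le> n" "N \<le> n" "N' \<le> n" by auto
    have "(\<Sum>i<n. d i) / real n - l = (\<Sum>i<n. d i - l) / real n"
      using n by (simp add: sum_subtractf diff_divide_distrib)
    moreover have "\<bar>\<Sum>i<n. d i - l\<bar> \<le> C + real n * (r / 2)"
    proof -
      have "\<bar>\<Sum>i<n. d i - l\<bar> \<le> (\<Sum>i<n. \<bar>d i - l\<bar>)" by (rule sum_abs)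
      also have "\<dots> = C + (\<Sum>i\<in>{N..<n}. \<bar>d i - l\<bar>)"
        unfolding C_def using n(2)
        by (subst sum.union_disjoint[symmetric]) (auto simp: ivl_disj_un intro!: sum.cong)
      also have "(\<Sum>i\<in>{N..<n}. \<bar>d i - l\<bar>) \<le> of_nat (card {N..<n}) * (r / 2)"
        using N by (intro sum_bounded_above) (simp add: less_imp_le)
      also have "\<dots> \<le> real n * (r / 2)" using r by (intro mult_right_mono) auto
      finally show ?thesis by simp
    qed
    ultimately have "\<bar>(\<Sum>i<n. d i) / real n - l\<bar> \<le> C / real n + r / 2"
      using n by (simp add: field_simps)
    moreover have "0 \<le> C" unfolding C_def by (simp add: sum_nonneg)
    with N'[OF n(3)] have "C / real n < r / 2" by simp
    ultimately show "norm ((\<Sum>i<n. d i) / real n - l) < r" unfolding real_norm_def by linarith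
  qed
qed

section \<open>Finite-valued variables: fibers, marginals, expectations\<close>

lemma simple_function_of_finite_type:
  fixes Z :: "'a \<Rightarrow> 'z::finite"
  shows "Z \<in> measurable M (count_space UNIV) \<Longrightarrow> simple_function M Z"
  by (auto simp: simple_function_def intro: measurable_sets)

lemma simple_function_cond_sets:
  assumes "simple_function M A" shows "{\<omega> \<in> space M. Q (A \<omega>)} \<in> sets M"
  using simple_functionD(2)[OF assms, of "Collect Q"]
  by (simp add: vimage_def Int_def conj_commute)

lemma prob_fiber:
  "\<P>(\<omega> in M. A \<omega> = a) = measure M (A -` {a} \<inter> space M)"
  by (rule arg_cong[where f = "measure M"]) auto

context prob_space
begin

lemma prob_eq_sum_fibers:
  assumes A: "simple_function M A" and T: "finite T" "A ` space M \<subseteq> T"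
  shows "\<P>(\<omega> in M. Q (A \<omega>)) = (\<Sum>a | a \<in> T \<and> Q a. \<P>(\<omega> in M. A \<omega> = a))"
proof -
  have "{\<omega> \<in> space M. Q (A \<omega>)} = (\<Union>a\<in>{a \<in> T. Q a}. {\<omega> \<in> space M. A \<omega> = a})"
    using T by auto
  moreover have "prob (\<Union>a\<in>{a \<in> T. Q a}. {\<omega> \<in> space M. A \<omega> = a}) =
      (\<Sum>a\<in>{a \<in> T. Q a}. \<P>(\<omega> in M. A \<omega> = a))"
    using T simple_function_cond_sets[OF A]
    by (intro finite_measure_finite_Union) (auto simp: disjoint_family_on_def)
  ultimately show ?thesis by simp
qed

lemma prob_marginal:
  assumes A: "simple_function M A" and C: "simple_function M C"
  shows "\<P>(\<omega> in M. Q (C \<omega>)) = (\<Sum>a\<in>A ` space M. \<P>(\<omega> in M. A \<omega> = a \<and> Q (C \<omega>)))"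
proof -
  have "{\<omega> \<in> space M. Q (C \<omega>)} = (\<Union>a\<in>A ` space M. {\<omega> \<in> space M. A \<omega> = a \<and> Q (C \<omega>)})"
    by auto
  moreover have "prob (\<Union>a\<in>A ` space M. {\<omega> \<in> space M. A \<omega> = a \<and> Q (C \<omega>)}) =
      (\<Sum>a\<in>A ` space M. \<P>(\<omega> in M. A \<omega> = a \<and> Q (C \<omega>)))"
    using simple_function_cond_sets[OF simple_function_Pair[OF A C], of "\<lambda>p. fst p = _ \<and> Q (snd p)"]
    by (intro finite_measure_finite_Union simple_functionD(1)[OF A]) (auto simp: disjoint_family_on_def)
  ultimately show ?thesis by simp
qed

lemma prob_image_cong:
  assumes A: "simple_function M A" and B: "simple_function M B"
    and eq: "\<And>a. \<P>(\<omega> in M. A \<omega> = a) = \<P>(\<omega> in M. B \<omega> = a)"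
  shows "\<P>(\<omega> in M. f (A \<omega>) = c) = \<P>(\<omega> in M. f (B \<omega>) = c)"
proof -
  have fin: "finite (A ` space M \<union> B ` space M)"
    using A B by (simp add: simple_functionD)
  show ?thesis
    using prob_eq_sum_fibers[OF A fin, of "\<lambda>a. f a = c"]
      prob_eq_sum_fibers[OF B fin, of "\<lambda>a. f a = c"] eq by simp
qed

text \<open>\<open>T\<close> may exceed the image of \<open>A\<close>, since surplus points have
  empty fibers. Hence two variables with equal laws but different images can be summed over one
  common set, and words can be summed over all words of a given length.\<close>

lemma expectation_simple_function:
  fixes f :: "'b \<Rightarrow> real"
  assumes A: "simple_function M A" and T: "finite T" "A ` space M \<subseteq> T"
  shows "expectation (\<lambda>\<omega>. f (A \<omega>)) = (\<Sum>a\<in>T. \<P>(\<omega> in M. A \<omega> = a) * f a)"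
proof -
  have "expectation (\<lambda>\<omega>. f (A \<omega>)) =
      expectation (\<lambda>\<omega>. \<Sum>a\<in>T. indicator {\<omega> \<in> space M. A \<omega> = a} \<omega> * f a)"
  proof (intro Bochner_Integration.integral_cong refl)
    fix \<omega> assume "\<omega> \<in> space M"
    with T show "f (A \<omega>) = (\<Sum>a\<in>T. indicator {\<omega> \<in> space M. A \<omega> = a} \<omega> * f a)"
      by (subst sum.remove[of _ "A \<omega>"]) (auto simp: indicator_def intro!: sum.neutral)
  qed
  also have "\<dots> = (\<Sum>a\<in>T. expectation (\<lambda>\<omega>. indicator {\<omega> \<in> space M. A \<omega> = a} \<omega> * f a))"
    using simple_function_cond_sets[OF A]
    by (intro Bochner_Integration.integral_sum integrable_mult_left integrable_real_indicator)
       (auto simp: emeasure_eq_measure)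
  also have "\<dots> = (\<Sum>a\<in>T. \<P>(\<omega> in M. A \<omega> = a) * f a)"
    using simple_function_cond_sets[OF A]
    by (intro sum.cong refl) (simp add: Int_absorb1 Collect_conj_eq)
  finally show ?thesis .
qed

lemma integrable_of_simple_function:
  fixes f :: "'b \<Rightarrow> real"
  assumes "simple_function M A" shows "integrable M (\<lambda>\<omega>. f (A \<omega>))"
proof -
  have "simple_function M (\<lambda>\<omega>. f (A \<omega>))"
    using simple_function_compose[OF assms, of f] by (simp add: comp_def)
  then show ?thesis
    by (intro integrable_simple_function) (auto simp: emeasure_eq_measure)
qed

text \<open>Only finitely many values occur, so those of probability zero together form a null set.
  This licenses splitting logarithms of products and quotients of fiber probabilities almost
  everywhere.\<close>

lemma AE_prob_fiber_pos:
  assumes A: "simple_function M A"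
  shows "AE \<omega> in M. 0 < \<P>(\<omega>' in M. A \<omega>' = A \<omega>)"
proof -
  have fin: "finite (A ` space M)" using A by (rule simple_functionD)
  let ?Q = "\<lambda>a. \<P>(\<omega>' in M. A \<omega>' = a) = 0"
  have "\<P>(\<omega> in M. ?Q (A \<omega>)) = 0"
    by (subst prob_eq_sum_fibers[OF A fin order_refl, of ?Q]) auto
  moreover have "{\<omega> \<in> space M. ?Q (A \<omega>)} \<in> events"
    using simple_function_cond_sets[OF A, of ?Q] .
  ultimately have "AE \<omega> in M. \<not> ?Q (A \<omega>)"
    by (subst (asm) prob_eq_0) (auto simp: AE_iff_measurable)
  then show ?thesis by eventually_elim (simp add: zero_less_measure_iff)
qed

end

section \<open>Information quantities as combinations of joint entropies\<close>

context information_space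
begin

lemma simple_function_comp':
  "simple_function M A \<Longrightarrow> simple_function M (\<lambda>\<omega>. f (A \<omega>))"
  using simple_function_compose[of M A f] by (simp add: comp_def)

text \<open>As expectations over the same space, entropies of different variables can be added under
  one integral, with no summation ranges to be matched.\<close>

lemma entropy_eq_expectation:
  assumes A: "simple_function M A"
  shows "\<H>(A) = - expectation (\<lambda>\<omega>. log b (\<P>(\<omega>' in M. A \<omega>' = A \<omega>)))"
  using entropy_simple_distributed[OF simple_distributedI[OF A measure_nonneg refl]]
  by (subst expectation_simple_function[OF A simple_functionD(1)[OF A] order_refl,
        where f = "\<lambda>a. log b (\<P>(\<omega>' in M. A \<omega>' = a))"]) (simp add: prob_fiber)

lemma entropy_cong_law:
  assumes A: "simple_function M A" and B: "simple_function M B"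
    and eq: "\<And>a. \<P>(\<omega> in M. A \<omega> = a) = \<P>(\<omega> in M. B \<omega> = a)"
  shows "\<H>(A) = \<H>(B)"
proof -
  let ?T = "A ` space M \<union> B ` space M"
  have fin: "finite ?T" using A B by (simp add: simple_functionD)
  show ?thesis
    unfolding entropy_eq_expectation[OF A] entropy_eq_expectation[OF B]
    using expectation_simple_function[OF A fin, of "\<lambda>a. log b (\<P>(\<omega>' in M. A \<omega>' = a))"]
      expectation_simple_function[OF B fin, of "\<lambda>a. log b (\<P>(\<omega>' in M. B \<omega>' = a))"]
    by (simp add: eq)
qed

lemma entropy_image_le:
  assumes "simple_function M A" shows "\<H>(\<lambda>\<omega>. f (A \<omega>)) \<le> \<H>(A)"
  using entropy_data_processing[OF assms, of f] by (simp add: comp_def)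

text \<open>Each variable is a function of the other, so data processing gives both inequalities.
  This is the repacking rule for tuples and lists; \<open>f\<close> and \<open>g\<close> need to be
  inverse only on the values taken.\<close>

lemma entropy_cong_bij:
  assumes A: "simple_function M A" and f: "\<And>\<omega>. B \<omega> = f (A \<omega>)" and g: "\<And>\<omega>. A \<omega> = g (B \<omega>)"
  shows "\<H>(A) = \<H>(B)"
proof (rule antisym)
  have B: "simple_function M B"
    using simple_function_comp'[OF A, of f] f by (metis ext)
  show "\<H>(B) \<le> \<H>(A)" using entropy_image_le[OF A, of f] f by (metis ext)
  show "\<H>(A) \<le> \<H>(B)" using entropy_image_le[OF B, of g] g by (metis ext)
qed

lemma entropy_swap:
  assumes "simple_function M A" "simple_function M B"
  shows "\<H>(\<lambda>\<omega>. (A \<omega>, B \<omega>)) = \<H>(\<lambda>\<omega>. (B \<omega>, A \<omega>))"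
  using assms by (intro entropy_cong_bij[where f = prod.swap and g = prod.swap] simple_function_Pair) auto

lemma conditional_entropy_entropy:
  assumes "simple_function M A" "simple_function M B"
  shows "\<H>(A | B) = \<H>(\<lambda>\<omega>. (A \<omega>, B \<omega>)) - \<H>(B)"
  using entropy_chain_rule[OF assms(2,1)] entropy_swap[OF assms] by simp

lemma mutual_information_entropy:
  assumes "simple_function M A" "simple_function M B"
  shows "\<I>(A ; B) = \<H>(A) + \<H>(B) - \<H>(\<lambda>\<omega>. (A \<omega>, B \<omega>))"
  using mutual_information_eq_entropy_conditional_entropy[OF assms]
    conditional_entropy_entropy[OF assms] by simp

text \<open>The defining sum is an expectation of the logarithm of a quotient of four fiber
  probabilities. Almost everywhere all four are positive, so the logarithm splits, and each piece
  has plus or minus an entropy as its expectation.\<close>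

lemma conditional_mutual_information_entropy:
  assumes A: "simple_function M A" and B: "simple_function M B" and C: "simple_function M C"
  shows "\<I>(A ; B | C) =
    \<H>(\<lambda>\<omega>. (A \<omega>, C \<omega>)) + \<H>(\<lambda>\<omega>. (B \<omega>, C \<omega>)) - \<H>(\<lambda>\<omega>. (A \<omega>, B \<omega>, C \<omega>)) - \<H>(C)"
proof -
  have eq: "count_space (B ` space M) \<Otimes>\<^sub>M count_space (C ` space M) =
      count_space (B ` space M \<times> C ` space M)"
    using B C by (simp add: pair_measure_count_space simple_functionD)
  have BC: "simple_function M (\<lambda>\<omega>. (B \<omega>, C \<omega>))" using B C by (rule simple_function_Pair)
  have ABC: "simple_function M (\<lambda>\<omega>. (A \<omega>, B \<omega>, C \<omega>))" using A BC by (rule simple_function_Pair)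
  have AC: "simple_function M (\<lambda>\<omega>. (A \<omega>, C \<omega>))" using A C by (rule simple_function_Pair)
  let ?p = "\<lambda>a b c. \<P>(\<omega> in M. A \<omega> = a \<and> B \<omega> = b \<and> C \<omega> = c)"
  let ?q = "\<lambda>a c. \<P>(\<omega> in M. A \<omega> = a \<and> C \<omega> = c)"
  let ?r = "\<lambda>b c. \<P>(\<omega> in M. B \<omega> = b \<and> C \<omega> = c)"
  let ?s = "\<lambda>c. \<P>(\<omega> in M. C \<omega> = c)"
  note dist = simple_distributedI[OF _ measure_nonneg prob_fiber]
  have "\<I>(A ; B | C) = (\<Sum>(a, b', c)\<in>(\<lambda>x. (A x, B x, C x)) ` space M.
      \<P>(\<omega> in M. (A \<omega>, B \<omega>, C \<omega>) = (a, b', c)) * log b (\<P>(\<omega> in M. (A \<omega>, B \<omega>, C \<omega>) = (a, b', c)) /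
        (\<P>(\<omega> in M. (A \<omega>, C \<omega>) = (a, c)) * (\<P>(\<omega> in M. (B \<omega>, C \<omega>) = (b', c)) / ?s c))))"
    by (rule conditional_mutual_information_eq[OF dist[OF C] dist[OF BC] dist[OF AC] dist[OF ABC]])
  also have "\<dots> = (\<Sum>t\<in>(\<lambda>x. (A x, B x, C x)) ` space M. \<P>(\<omega> in M. (A \<omega>, B \<omega>, C \<omega>) = t) *
      (case t of (a, b', c) \<Rightarrow> log b (?p a b' c / (?q a c * (?r b' c / ?s c)))))"
    by (intro sum.cong) auto
  also have "\<dots> = expectation (\<lambda>\<omega>. log b (?p (A \<omega>) (B \<omega>) (C \<omega>) /
      (?q (A \<omega>) (C \<omega>) * (?r (B \<omega>) (C \<omega>) / ?s (C \<omega>)))))"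
    using expectation_simple_function[OF ABC simple_functionD(1)[OF ABC] order_refl,
        of "\<lambda>(a, b', c). log b (?p a b' c / (?q a c * (?r b' c / ?s c)))"] by simp
  also have "\<dots> = expectation (\<lambda>\<omega>. log b (?p (A \<omega>) (B \<omega>) (C \<omega>)) + log b (?s (C \<omega>)) -
      log b (?q (A \<omega>) (C \<omega>)) - log b (?r (B \<omega>) (C \<omega>)))"
  proof (rule integral_cong_AE)
    show "AE \<omega> in M. log b (?p (A \<omega>) (B \<omega>) (C \<omega>) /
        (?q (A \<omega>) (C \<omega>) * (?r (B \<omega>) (C \<omega>) / ?s (C \<omega>)))) =
        log b (?p (A \<omega>) (B \<omega>) (C \<omega>)) + log b (?s (C \<omega>)) -
        log b (?q (A \<omega>) (C \<omega>)) - log b (?r (B \<omega>) (C \<omega>))"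
      using AE_prob_fiber_pos[OF ABC] AE_prob_fiber_pos[OF AC] AE_prob_fiber_pos[OF BC]
        AE_prob_fiber_pos[OF C]
      by eventually_elim (simp add: log_mult log_divide)
    show "(\<lambda>\<omega>. log b (?p (A \<omega>) (B \<omega>) (C \<omega>) /
        (?q (A \<omega>) (C \<omega>) * (?r (B \<omega>) (C \<omega>) / ?s (C \<omega>))))) \<in> borel_measurable M"
      using integrable_of_simple_function[OF ABC,
          of "\<lambda>(a, b', c). log b (?p a b' c / (?q a c * (?r b' c / ?s c)))"]
      by (intro borel_measurable_integrable) simp
    show "(\<lambda>\<omega>. log b (?p (A \<omega>) (B \<omega>) (C \<omega>)) + log b (?s (C \<omega>)) -
        log b (?q (A \<omega>) (C \<omega>)) - log b (?r (B \<omega>) (C \<omega>))) \<in> borel_measurable M"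
      using integrable_of_simple_function[OF ABC,
          of "\<lambda>(a, b', c). log b (?p a b' c) + log b (?s c) - log b (?q a c) - log b (?r b' c)"]
      by (intro borel_measurable_integrable) simp
  qed
  also have "\<dots> = \<H>(\<lambda>\<omega>. (A \<omega>, C \<omega>)) + \<H>(\<lambda>\<omega>. (B \<omega>, C \<omega>)) - \<H>(\<lambda>\<omega>. (A \<omega>, B \<omega>, C \<omega>)) - \<H>(C)"
    unfolding entropy_eq_expectation[OF ABC] entropy_eq_expectation[OF AC]
      entropy_eq_expectation[OF BC] entropy_eq_expectation[OF C]
    using integrable_of_simple_function[OF ABC, of "\<lambda>(a, b', c). log b (?p a b' c)"]
      integrable_of_simple_function[OF AC, of "\<lambda>(a, c). log b (?q a c)"]
      integrable_of_simple_function[OF BC, of "\<lambda>(b', c). log b (?r b' c)"]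
      integrable_of_simple_function[OF C, of "\<lambda>c. log b (?s c)"]
    by simp
  finally show ?thesis .
qed

text \<open>Nonnegativity of conditional mutual information, in the form in which conditioning
  arguments use it below.\<close>

lemma entropy_submodular:
  assumes "simple_function M A" "simple_function M B" "simple_function M C"
  shows "\<H>(\<lambda>\<omega>. (A \<omega>, B \<omega>, C \<omega>)) + \<H>(C) \<le> \<H>(\<lambda>\<omega>. (A \<omega>, C \<omega>)) + \<H>(\<lambda>\<omega>. (B \<omega>, C \<omega>))"
  using conditional_mutual_information_nonneg[OF assms]
    conditional_mutual_information_entropy[OF assms] by linarith

text \<open>The difference of the two sides is I(A;B|C,f(A)), by the chain rule. Its nonnegativity
  is submodularity with \<open>(C, f A)\<close> as the shared variable.\<close>

lemma conditional_mutual_information_image_le: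
  assumes A: "simple_function M A" and B: "simple_function M B" and C: "simple_function M C"
  shows "\<I>((\<lambda>\<omega>. f (A \<omega>)) ; B | C) \<le> \<I>(A ; B | C)"
proof -
  have fA: "simple_function M (\<lambda>\<omega>. f (A \<omega>))" using simple_function_comp'[OF A] .
  have "\<H>(\<lambda>\<omega>. (A \<omega>, B \<omega>, C \<omega>, f (A \<omega>))) + \<H>(\<lambda>\<omega>. (C \<omega>, f (A \<omega>))) \<le>
      \<H>(\<lambda>\<omega>. (A \<omega>, C \<omega>, f (A \<omega>))) + \<H>(\<lambda>\<omega>. (B \<omega>, C \<omega>, f (A \<omega>)))"
    using A B C fA by (intro entropy_submodular simple_function_Pair)
  moreover have "\<H>(\<lambda>\<omega>. (A \<omega>, B \<omega>, C \<omega>)) = \<H>(\<lambda>\<omega>. (A \<omega>, B \<omega>, C \<omega>, f (A \<omega>)))"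
    using A B C
    by (intro entropy_cong_bij[where f = "\<lambda>(a, b, c). (a, b, c, f a)" and g = "\<lambda>(a, b, c, d). (a, b, c)"]
        simple_function_Pair) auto
  moreover have "\<H>(\<lambda>\<omega>. (A \<omega>, C \<omega>)) = \<H>(\<lambda>\<omega>. (A \<omega>, C \<omega>, f (A \<omega>)))"
    using A B C
    by (intro entropy_cong_bij[where f = "\<lambda>(a, c). (a, c, f a)" and g = "\<lambda>(a, c, d). (a, c)"]
        simple_function_Pair) auto
  moreover have "\<H>(\<lambda>\<omega>. (f (A \<omega>), B \<omega>, C \<omega>)) = \<H>(\<lambda>\<omega>. (B \<omega>, C \<omega>, f (A \<omega>)))"
    using fA B C
    by (intro entropy_cong_bij[where f = "\<lambda>(d, b, c). (b, c, d)" and g = "\<lambda>(b, c, d). (d, b, c)"]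
        simple_function_Pair) auto
  moreover have "\<H>(\<lambda>\<omega>. (f (A \<omega>), C \<omega>)) = \<H>(\<lambda>\<omega>. (C \<omega>, f (A \<omega>)))"
    using fA C by (rule entropy_swap)
  ultimately show ?thesis
    unfolding conditional_mutual_information_entropy[OF A B C]
      conditional_mutual_information_entropy[OF fA B C] by simp
qed

lemma conditional_mutual_information_commute:
  assumes A: "simple_function M A" and B: "simple_function M B" and C: "simple_function M C"
  shows "\<I>(A ; B | C) = \<I>(B ; A | C)"
proof -
  have "\<H>(\<lambda>\<omega>. (A \<omega>, B \<omega>, C \<omega>)) = \<H>(\<lambda>\<omega>. (B \<omega>, A \<omega>, C \<omega>))"
    using A B C
    by (intro entropy_cong_bij[where f = "\<lambda>(a, b, c). (b, a, c)" and g = "\<lambda>(a, b, c). (b, a, c)"]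
        simple_function_Pair) auto
  then show ?thesis
    by (simp add: conditional_mutual_information_entropy A B C)
qed

text \<open>Data processing in both arguments squeezes the value between 0 and 0. One conditional
  independence of the pair process thus passes to all functions of its two sides.\<close>

lemma conditional_mutual_information_image_eq_0:
  assumes A: "simple_function M A" and B: "simple_function M B" and C: "simple_function M C"
    and "\<I>(A ; B | C) = 0"
  shows "\<I>((\<lambda>\<omega>. f (A \<omega>)) ; (\<lambda>\<omega>. g (B \<omega>)) | C) = 0"
proof -
  have fA: "simple_function M (\<lambda>\<omega>. f (A \<omega>))" and gB: "simple_function M (\<lambda>\<omega>. g (B \<omega>))"
    using A B simple_function_comp' by blast+
  have "\<I>((\<lambda>\<omega>. f (A \<omega>)) ; (\<lambda>\<omega>. g (B \<omega>)) | C) \<le> \<I>(A ; (\<lambda>\<omega>. g (B \<omega>)) | C)"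
    using A gB C by (rule conditional_mutual_information_image_le)
  also have "\<dots> \<le> \<I>(A ; B | C)"
    using conditional_mutual_information_image_le[OF B A C, of g]
      conditional_mutual_information_commute[OF B A C]
      conditional_mutual_information_commute[OF gB A C] by simp
  finally show ?thesis
    using assms conditional_mutual_information_nonneg[OF fA gB C] by simp
qed

text \<open>The factors \<open>f\<close> and \<open>g\<close> need not be probabilities. Summing
  them out to \<open>F\<close> and \<open>G\<close> gives the marginals F(c) g(b,c), f(a,c) G(c) and
  F(c) G(c), and the quotient under the logarithm cancels to 1.\<close>

lemma conditional_mutual_information_eq_0I:
  fixes f g :: "_ \<Rightarrow> _ \<Rightarrow> real"
  assumes A: "simple_function M A" and B: "simple_function M B" and C: "simple_function M C"
    and fact: "\<And>a b c. \<P>(\<omega> in M. A \<omega> = a \<and> B \<omega> = b \<and> C \<omega> = c) = f a c * g b c"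
  shows "\<I>(A ; B | C) = 0"
proof -
  have BC: "simple_function M (\<lambda>\<omega>. (B \<omega>, C \<omega>))" using B C by (rule simple_function_Pair)
  have ABC: "simple_function M (\<lambda>\<omega>. (A \<omega>, B \<omega>, C \<omega>))" using A BC by (rule simple_function_Pair)
  have AC: "simple_function M (\<lambda>\<omega>. (A \<omega>, C \<omega>))" using A C by (rule simple_function_Pair)
  define F where "F c = (\<Sum>a\<in>A ` space M. f a c)" for c
  define G where "G c = (\<Sum>b\<in>B ` space M. g b c)" for c
  have pbc: "\<P>(\<omega> in M. B \<omega> = b \<and> C \<omega> = c) = F c * g b c" for b c
    using prob_marginal[OF A BC, of "\<lambda>(b', c'). b' = b \<and> c' = c"]
    by (simp add: fact F_def sum_distrib_right)
  have pac: "\<P>(\<omega> in M. A \<omega> = a \<and> C \<omega> = c) = f a c * G c" for a c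
    using prob_marginal[OF B AC, of "\<lambda>(a', c'). a' = a \<and> c' = c"]
    by (simp add: fact[symmetric] G_def sum_distrib_left conj_ac)
  have pc: "\<P>(\<omega> in M. C \<omega> = c) = F c * G c" for c
    using prob_marginal[OF B C, of "\<lambda>c'. c' = c"]
    by (simp add: pbc G_def sum_distrib_left)
  note dist = simple_distributedI[OF _ measure_nonneg prob_fiber]
  have "\<I>(A ; B | C) = (\<Sum>(a, b', c)\<in>(\<lambda>x. (A x, B x, C x)) ` space M.
      \<P>(\<omega> in M. (A \<omega>, B \<omega>, C \<omega>) = (a, b', c)) * log b (\<P>(\<omega> in M. (A \<omega>, B \<omega>, C \<omega>) = (a, b', c)) /
        (\<P>(\<omega> in M. (A \<omega>, C \<omega>) = (a, c)) * (\<P>(\<omega> in M. (B \<omega>, C \<omega>) = (b', c)) / \<P>(\<omega> in M. C \<omega> = c)))))"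
    by (rule conditional_mutual_information_eq[OF dist[OF C] dist[OF BC] dist[OF AC] dist[OF ABC]])
  also have "\<dots> = (\<Sum>(a, b', c)\<in>(\<lambda>x. (A x, B x, C x)) ` space M.
      f a c * g b' c * log b (f a c * g b' c / (f a c * G c * (F c * g b' c / (F c * G c)))))"
    by (simp add: fact pac pbc pc)
  also have "\<dots> = 0"
  proof (intro sum.neutral ballI, clarify)
    fix \<omega>
    let ?a = "A \<omega>" and ?b = "B \<omega>" and ?c = "C \<omega>"
    \<comment> \<open>The cancellation needs \<open>F\<close> and \<open>G\<close> to be nonzero at
      \<open>c\<close>. Otherwise the event that \<open>C\<close> equals \<open>c\<close> is null,
      and the weight in front of the logarithm vanishes.\<close>
    have "f ?a ?c * g ?b ?c = 0 \<or> F ?c \<noteq> 0 \<and> G ?c \<noteq> 0"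
    proof (rule disjCI)
      assume "\<not> (F ?c \<noteq> 0 \<and> G ?c \<noteq> 0)"
      then have "\<P>(\<omega>' in M. C \<omega>' = ?c) = 0" unfolding pc by simp
      moreover have "\<P>(\<omega>' in M. A \<omega>' = ?a \<and> B \<omega>' = ?b \<and> C \<omega>' = ?c) \<le> \<P>(\<omega>' in M. C \<omega>' = ?c)"
        using simple_function_cond_sets[OF C] by (intro finite_measure_mono) auto
      ultimately show "f ?a ?c * g ?b ?c = 0"
        by (simp add: fact[symmetric] measure_le_0_iff)
    qed
    then show "f ?a ?c * g ?b ?c *
        log b (f ?a ?c * g ?b ?c / (f ?a ?c * G ?c * (F ?c * g ?b ?c / (F ?c * G ?c)))) = 0"
      by (cases "f ?a ?c * g ?b ?c = 0") auto
  qed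
  finally show ?thesis .
qed

end

section \<open>Markov chains and memoryless channels\<close>

lemma block_0 [simp]: "block Z 0 \<omega> = []"
  by (simp add: block_def)

lemma length_block [simp]: "length (block Z n \<omega>) = n"
  by (simp add: block_def)

lemma nth_block [simp]: "i < n \<Longrightarrow> block Z n \<omega> ! i = Z i \<omega>"
  by (simp add: block_def)

lemma block_Suc: "block Z (Suc n) \<omega> = block Z n \<omega> @ [Z n \<omega>]"
  by (simp add: block_def)

lemma block_Suc_Cons: "block Z (Suc n) \<omega> = Z 0 \<omega> # block (\<lambda>i. Z (Suc i)) n \<omega>"
  by (rule nth_equalityI) (auto simp: nth_Cons split: nat.split)

lemma block_eq_iff: "block Z n \<omega> = zs \<longleftrightarrow> length zs = n \<and> (\<forall>i<n. Z i \<omega> = zs ! i)"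
  by (auto simp: list_eq_iff_nth_eq)

lemma simple_function_block:
  assumes "\<And>i. simple_function M (Z i)" shows "simple_function M (block Z n)"
proof (induction n)
  case 0
  have "block Z 0 = (\<lambda>\<omega>. [])" by auto
  then show ?case by simp
next
  case (Suc n)
  have "block Z (Suc n) = (\<lambda>(zs, z). zs @ [z]) \<circ> (\<lambda>\<omega>. (block Z n \<omega>, Z n \<omega>))"
    by (auto simp: block_Suc)
  then show ?case
    by (simp only: simple_function_compose simple_function_Pair Suc assms)
qed

section \<open>Path probabilities, stationarity and the pair process\<close>

context prob_space
begin

text \<open>Multiplying out the conditional probability removes the side condition: after a null
  history both sides are 0. In this form path probabilities follow by a plain induction.\<close>

lemma markov_chain_iff:
  "markov_chain \<mu> K Z \<longleftrightarrow>
     (\<forall>n. random_variable (count_space UNIV) (Z n)) \<and>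
     (\<forall>z. \<P>(\<omega> in M. Z 0 \<omega> = z) = \<mu> z) \<and>
     (\<forall>n z. \<P>(\<omega> in M. \<forall>i\<le>Suc n. Z i \<omega> = z i) =
        \<P>(\<omega> in M. \<forall>i\<le>n. Z i \<omega> = z i) * K (z n) (z (Suc n)))"
proof -
  have "(0 < \<P>(\<omega> in M. \<forall>i\<le>n. Z i \<omega> = z i) \<longrightarrow>
        \<P>(\<omega> in M. Z (Suc n) \<omega> = z (Suc n) \<bar> \<forall>i\<le>n. Z i \<omega> = z i) = K (z n) (z (Suc n))) \<longleftrightarrow>
      \<P>(\<omega> in M. \<forall>i\<le>Suc n. Z i \<omega> = z i) =
        \<P>(\<omega> in M. \<forall>i\<le>n. Z i \<omega> = z i) * K (z n) (z (Suc n))"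
    if rv: "\<And>n. random_variable (count_space UNIV) (Z n)" for n z
  proof -
    let ?p = "\<P>(\<omega> in M. \<forall>i\<le>n. Z i \<omega> = z i)"
    let ?q = "\<P>(\<omega> in M. \<forall>i\<le>Suc n. Z i \<omega> = z i)"
    have [measurable]: "Z n \<in> measurable M (count_space UNIV)" for n by (rule rv)
    have "?q \<le> ?p" by (intro finite_measure_mono) auto
    moreover have "\<P>(\<omega> in M. Z (Suc n) \<omega> = z (Suc n) \<bar> \<forall>i\<le>n. Z i \<omega> = z i) = ?q / ?p"
      unfolding cond_prob_def
      by (intro arg_cong2[where f = "(/)"] arg_cong[where f = prob]) (auto simp: le_Suc_eq)
    moreover have "0 < ?p \<or> ?p = 0"
      by (simp add: zero_less_measure_iff)
    ultimately show ?thesis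
      by (auto simp: field_simps measure_le_0_iff)
  qed
  then show ?thesis unfolding markov_chain_def by blast
qed

lemma markov_chain_random_variable:
  "markov_chain \<mu> K Z \<Longrightarrow> random_variable (count_space UNIV) (Z n)"
  by (simp add: markov_chain_def)

lemma markov_chain_simple_function: "markov_chain \<mu> K Z \<Longrightarrow> simple_function M (Z n)"
  by (rule simple_function_of_finite_type[OF markov_chain_random_variable])

lemma markov_chain_path:
  assumes "markov_chain \<mu> K Z"
  shows "\<P>(\<omega> in M. \<forall>i\<le>n. Z i \<omega> = z i) = \<mu> (z 0) * (\<Prod>i<n. K (z i) (z (Suc i)))"
  using assms unfolding markov_chain_iff by (induction n) auto

lemma markov_chain_block:
  assumes "markov_chain \<mu> K Z" and "length zs = Suc n"
  shows "\<P>(\<omega> in M. block Z (Suc n) \<omega> = zs) = \<mu> (zs ! 0) * (\<Prod>i<n. K (zs ! i) (zs ! Suc i))"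
  using markov_chain_path[OF assms(1), of n "\<lambda>i. zs ! i"] assms(2)
  by (simp add: block_eq_iff less_Suc_eq_le)

text \<open>Summing the path formula over the state dropped in front replaces the initial weight by
  the law after one step, which invariance identifies with \<open>\<mu>\<close>. The path formula
  for all lengths then gives back the chain property, and induction on \<open>k\<close> iterates the
  shift.\<close>

lemma markov_chain_shift:
  assumes Z: "markov_chain \<mu> K Z" and inv: "\<And>z'. (\<Sum>z\<in>UNIV. \<mu> z * K z z') = \<mu> z'"
  shows "markov_chain \<mu> K (\<lambda>i. Z (i + k))"
proof (induction k)
  case 0
  show ?case using Z by simp
next
  case (Suc k)
  let ?Z = "\<lambda>i. Z (i + k)"
  have path: "\<P>(\<omega> in M. \<forall>i\<le>n. ?Z (Suc i) \<omega> = z i) = \<mu> (z 0) * (\<Prod>i<n. K (z i) (z (Suc i)))" for n z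
  proof -
    have sf: "simple_function M (?Z 0)" using markov_chain_simple_function[OF Suc] .
    have sfb: "simple_function M (block (\<lambda>i. ?Z (Suc i)) (Suc n))"
      using markov_chain_simple_function[OF Suc] by (intro simple_function_block)
    have eq: "(\<forall>i\<le>n. ?Z (Suc i) \<omega> = z i) \<longleftrightarrow> block (\<lambda>i. ?Z (Suc i)) (Suc n) \<omega> = map z [0..<Suc n]" for \<omega>
      unfolding block_eq_iff by (auto simp: less_Suc_eq_le simp del: upt_Suc)
    have "\<P>(\<omega> in M. \<forall>i\<le>n. ?Z (Suc i) \<omega> = z i) =
        (\<Sum>a\<in>?Z 0 ` space M. \<P>(\<omega> in M. ?Z 0 \<omega> = a \<and> (\<forall>i\<le>n. ?Z (Suc i) \<omega> = z i)))"
      unfolding eq by (rule prob_marginal[OF sf sfb])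
    also have "\<dots> = (\<Sum>a\<in>UNIV. \<P>(\<omega> in M. ?Z 0 \<omega> = a \<and> (\<forall>i\<le>n. ?Z (Suc i) \<omega> = z i)))"
      by (intro sum.mono_neutral_left ballI)
         (auto intro!: trans[OF arg_cong[where f = prob and y = "{}"] measure_empty])
    \<comment> \<open>The dropped state \<open>a\<close> is put back in front of \<open>z\<close> by
      \<open>case_nat\<close>, so that the path formula of the unshifted chain applies.\<close>
    also have "\<dots> = (\<Sum>a\<in>UNIV. \<P>(\<omega> in M. \<forall>i\<le>Suc n. ?Z i \<omega> = case_nat a z i))"
      by (intro sum.cong arg_cong[where f = prob] Collect_cong refl)
         (auto simp: less_Suc_eq_le split: nat.split)
    also have "\<dots> = (\<Sum>a\<in>UNIV. \<mu> a * K a (z 0)) * (\<Prod>i<n. K (z i) (z (Suc i)))"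
      by (simp only: markov_chain_path[OF Suc] prod.lessThan_Suc_shift)
         (simp add: sum_distrib_right mult.assoc comp_def)
    finally show ?thesis by (simp add: inv)
  qed
  have "\<P>(\<omega> in M. ?Z (Suc 0) \<omega> = z) = \<mu> z" for z
    using path[of 0 "\<lambda>_. z"] by simp
  then show ?case
    using markov_chain_random_variable[OF Z] path
    unfolding markov_chain_iff by simp
qed

lemma markov_chain_shift_law:
  assumes Z: "markov_chain \<mu> K Z" and inv: "\<And>z'. (\<Sum>z\<in>UNIV. \<mu> z * K z z') = \<mu> z'"
  shows "\<P>(\<omega> in M. f (block (\<lambda>i. Z (i + k)) n \<omega>) = c) = \<P>(\<omega> in M. f (block Z n \<omega>) = c)"
proof (rule prob_image_cong[of "block (\<lambda>i. Z (i + k)) n" "block Z n" f c])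
  show "simple_function M (block (\<lambda>i. Z (i + k)) n)" "simple_function M (block Z n)"
    using markov_chain_simple_function[OF Z] by (auto intro: simple_function_block)
  fix zs
  show "\<P>(\<omega> in M. block (\<lambda>i. Z (i + k)) n \<omega> = zs) = \<P>(\<omega> in M. block Z n \<omega> = zs)"
  proof (cases "length zs = n")
    case True
    then show ?thesis
      using markov_chain_block[OF Z, of zs] markov_chain_block[OF markov_chain_shift[OF Z inv], of zs]
      by (cases n) auto
  qed (auto simp: block_eq_iff)
qed

text \<open>The law of a joint path is that of the X-path times a product of channel entries. One
  more step multiplies it by one entry of \<open>P\<close> and one of \<open>W\<close>, neither of
  which involves the observation being left.\<close>

lemma observed_through_markov_chain:
  assumes X: "markov_chain \<mu> P X" and Y: "observed_through W X Y"
  shows "markov_chain (\<lambda>(x, y). \<mu> x * W x y) (\<lambda>(x, y) (x', y'). P x x' * W x' y')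
    (\<lambda>n \<omega>. (X n \<omega>, Y n \<omega>))"
proof -
  have [measurable]: "X n \<in> measurable M (count_space UNIV)" for n
    using X by (rule markov_chain_random_variable)
  have [measurable]: "Y n \<in> measurable M (count_space UNIV)" for n
    using Y by (simp add: observed_through_def)
  have joint: "\<P>(\<omega> in M. \<forall>i\<le>n. (X i \<omega>, Y i \<omega>) = z i) =
      \<P>(\<omega> in M. \<forall>i\<le>n. X i \<omega> = fst (z i)) * (\<Prod>i\<le>n. W (fst (z i)) (snd (z i)))" for n z
  proof -
    let ?p = "\<P>(\<omega> in M. \<forall>i\<le>n. X i \<omega> = fst (z i))"
    have eq: "\<P>(\<omega> in M. \<forall>i\<le>n. (X i \<omega>, Y i \<omega>) = z i) =
        \<P>(\<omega> in M. (\<forall>i\<le>n. Y i \<omega> = snd (z i)) \<and> (\<forall>i\<le>n. X i \<omega> = fst (z i)))"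
      by (intro arg_cong[where f = prob]) (auto simp: prod_eq_iff)
    show ?thesis
    proof (cases "?p = 0")
      \<comment> \<open>On a null X-path the channel assumption is silent, but then both sides
        vanish.\<close>
      case True
      have "\<P>(\<omega> in M. (\<forall>i\<le>n. Y i \<omega> = snd (z i)) \<and> (\<forall>i\<le>n. X i \<omega> = fst (z i))) \<le> ?p"
        by (intro finite_measure_mono) auto
      then show ?thesis unfolding eq using True by (simp add: measure_le_0_iff)
    next
      case False
      then have "0 < ?p" by (simp add: zero_less_measure_iff)
      moreover from this have "\<P>(\<omega> in M. \<forall>i\<le>n. Y i \<omega> = snd (z i) \<bar> \<forall>i\<le>n. X i \<omega> = fst (z i)) =
          (\<Prod>i\<le>n. W (fst (z i)) (snd (z i)))"
        using Y unfolding observed_through_def by auto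
      ultimately show ?thesis
        unfolding eq cond_prob_def by (simp add: field_simps)
    qed
  qed
  have "\<P>(\<omega> in M. (X 0 \<omega>, Y 0 \<omega>) = z) = \<mu> (fst z) * W (fst z) (snd z)" for z
    using joint[of 0 "\<lambda>_. z"] X by (simp add: markov_chain_def)
  moreover have "\<P>(\<omega> in M. \<forall>i\<le>Suc n. (X i \<omega>, Y i \<omega>) = z i) =
      \<P>(\<omega> in M. \<forall>i\<le>n. (X i \<omega>, Y i \<omega>) = z i) *
      (P (fst (z n)) (fst (z (Suc n))) * W (fst (z (Suc n))) (snd (z (Suc n))))" for n z
  proof -
    have "\<P>(\<omega> in M. \<forall>i\<le>Suc n. X i \<omega> = fst (z i)) =
        \<P>(\<omega> in M. \<forall>i\<le>n. X i \<omega> = fst (z i)) * P (fst (z n)) (fst (z (Suc n)))"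
      using X unfolding markov_chain_iff by (elim conjE allE[of _ n] allE[of _ "\<lambda>i. fst (z i)"])
    then show ?thesis unfolding joint by simp
  qed
  moreover have "random_variable (count_space UNIV) (\<lambda>\<omega>. (X n \<omega>, Y n \<omega>))" for n
    using measurable_Pair[of "X n" M "count_space UNIV" "Y n" "count_space UNIV"]
    by (simp add: pair_measure_count_space)
  ultimately show ?thesis
    unfolding markov_chain_iff by (simp add: case_prod_beta)
qed

end

context information_space
begin

lemma markov_chain_entropy_shift:
  assumes Z: "markov_chain \<mu> K Z" and inv: "\<And>z'. (\<Sum>z\<in>UNIV. \<mu> z * K z z') = \<mu> z'"
  shows "\<H>(\<lambda>\<omega>. f (block (\<lambda>i. Z (i + k)) n \<omega>)) = \<H>(\<lambda>\<omega>. f (block Z n \<omega>))"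
  by (rule entropy_cong_law[OF simple_function_comp' simple_function_comp'
        markov_chain_shift_law[OF Z inv]])
     (intro simple_function_block markov_chain_simple_function[OF Z])+

text \<open>If the kernel sees its starting state only through \<open>\<phi>\<close>, conditioning
  on \<phi>(Z_n) already separates past and next state. For the pair process \<open>\<phi>\<close>
  is the projection to the hidden state.\<close>

lemma markov_chain_past_future:
  assumes Z: "markov_chain \<mu> K Z" and K: "\<And>z z'. K z z' = \<kappa> (\<phi> z) z'"
  shows "\<I>(block Z (Suc n) ; Z (Suc n) | (\<lambda>\<omega>. \<phi> (Z n \<omega>))) = 0"
proof (rule conditional_mutual_information_eq_0I)
  show "simple_function M (block Z (Suc n))" "simple_function M (Z (Suc n))"
    "simple_function M (\<lambda>\<omega>. \<phi> (Z n \<omega>))"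
    using markov_chain_simple_function[OF Z] simple_function_comp'
    by (blast intro: simple_function_block)+
  fix zs z c
  have "\<P>(\<omega> in M. block Z (Suc n) \<omega> = zs \<and> Z (Suc n) \<omega> = z \<and> \<phi> (Z n \<omega>) = c) =
      \<P>(\<omega> in M. block Z (Suc n) \<omega> = zs) * \<kappa> c z" if zs: "length zs = Suc n" "\<phi> (zs ! n) = c"
  proof -
    have "\<P>(\<omega> in M. block Z (Suc n) \<omega> = zs \<and> Z (Suc n) \<omega> = z \<and> \<phi> (Z n \<omega>) = c) =
        \<P>(\<omega> in M. \<forall>i\<le>Suc n. Z i \<omega> = (if i \<le> n then zs ! i else z))"
      using zs by (intro arg_cong[where f = prob] Collect_cong)
        (auto simp: block_eq_iff less_Suc_eq_le le_Suc_eq)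
    also have "\<dots> = \<P>(\<omega> in M. \<forall>i\<le>n. Z i \<omega> = (if i \<le> n then zs ! i else z)) * K (zs ! n) z"
      using Z unfolding markov_chain_iff by simp
    also have "\<P>(\<omega> in M. \<forall>i\<le>n. Z i \<omega> = (if i \<le> n then zs ! i else z)) =
        \<P>(\<omega> in M. block Z (Suc n) \<omega> = zs)"
      using zs by (intro arg_cong[where f = prob] Collect_cong)
        (auto simp: block_eq_iff less_Suc_eq_le)
    finally show ?thesis using zs K by simp
  qed
  moreover have "{\<omega> \<in> space M. block Z (Suc n) \<omega> = zs \<and> Z (Suc n) \<omega> = z \<and> \<phi> (Z n \<omega>) = c} = {}"
    if "\<not> (length zs = Suc n \<and> \<phi> (zs ! n) = c)"
    using that by (auto simp: block_eq_iff)
  \<comment> \<open>The word \<open>zs\<close> determines the value \<open>c\<close>, so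
    compatibility of the two is a condition on the first factor only; incompatible triples have
    empty fibers.\<close>
  ultimately show "\<P>(\<omega> in M. block Z (Suc n) \<omega> = zs \<and> Z (Suc n) \<omega> = z \<and> \<phi> (Z n \<omega>) = c) =
      (if length zs = Suc n \<and> \<phi> (zs ! n) = c then \<P>(\<omega> in M. block Z (Suc n) \<omega> = zs) else 0) * \<kappa> c z"
    by (cases "length zs = Suc n \<and> \<phi> (zs ! n) = c") (auto simp only: measure_empty simp_thms mult_zero_left if_True if_False)
qed

end

section \<open>Hidden Markov chains\<close>

locale hidden_markov_chain = information_space M b for M :: "'w measure" and b :: real +
  fixes P :: "'x::finite \<Rightarrow> 'x \<Rightarrow> real" and \<mu> :: "'x \<Rightarrow> real"
    and W :: "'x \<Rightarrow> 'y::finite \<Rightarrow> real"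
    and X :: "nat \<Rightarrow> 'w \<Rightarrow> 'x" and Y :: "nat \<Rightarrow> 'w \<Rightarrow> 'y"
  assumes invariant: "invariant_distribution \<mu> P"
    and chain: "markov_chain \<mu> P X"
    and channel: "row_stochastic W"
    and observed: "observed_through W X Y"
begin

section \<open>Stationarity and conditional independences of the pair process\<close>

definition joint :: "nat \<Rightarrow> 'w \<Rightarrow> 'x \<times> 'y" where
  "joint n \<omega> = (X n \<omega>, Y n \<omega>)"

abbreviation joint_init :: "'x \<times> 'y \<Rightarrow> real" where
  "joint_init \<equiv> \<lambda>(x, y). \<mu> x * W x y"

abbreviation joint_kernel :: "'x \<times> 'y \<Rightarrow> 'x \<times> 'y \<Rightarrow> real" where
  "joint_kernel \<equiv> \<lambda>(x, y) (x', y'). P x x' * W x' y'"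

lemma joint_chain: "markov_chain joint_init joint_kernel joint"
  using observed_through_markov_chain[OF chain observed]
  by (simp add: joint_def[abs_def])

lemma joint_invariant: "(\<Sum>s\<in>UNIV. joint_init s * joint_kernel s s') = joint_init s'"
proof -
  obtain x' y' where s': "s' = (x', y')" by (cases s')
  have "(\<Sum>s\<in>UNIV. joint_init s * joint_kernel s s') =
      (\<Sum>x\<in>UNIV. \<Sum>y\<in>UNIV. W x y * (\<mu> x * P x x' * W x' y'))"
    unfolding UNIV_Times_UNIV[symmetric] sum.cartesian_product
    by (intro sum.cong) (auto simp: s')
  also have "\<dots> = (\<Sum>x\<in>UNIV. \<mu> x * P x x' * W x' y')"
    using channel unfolding row_stochastic_def by (simp flip: sum_distrib_right)
  also have "\<dots> = \<mu> x' * W x' y'"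
    using invariant unfolding invariant_distribution_def by (simp flip: sum_distrib_right)
  finally show ?thesis by (simp add: s')
qed

lemma simple_function_X [simp]: "simple_function M (X n)"
  using chain by (rule markov_chain_simple_function)

lemma simple_function_Y [simp]: "simple_function M (Y n)"
  using observed by (intro simple_function_of_finite_type) (simp add: observed_through_def)

lemma simple_function_block_X [simp]: "simple_function M (block X n)"
  by (intro simple_function_block simple_function_X)

lemma simple_function_block_Y [simp]: "simple_function M (block Y n)"
  by (intro simple_function_block simple_function_Y)

lemma block_Y_eq: "block (\<lambda>i. Y (i + k)) n = (\<lambda>\<omega>. map snd (block (\<lambda>i. joint (i + k)) n \<omega>))"
  by (rule ext) (simp add: block_def joint_def)

lemma law_shift_Y:
  "\<P>(\<omega> in M. f (block (\<lambda>i. Y (i + k)) n \<omega>) = c) = \<P>(\<omega> in M. f (block Y n \<omega>) = c)"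
  using markov_chain_shift_law[OF joint_chain joint_invariant, of "\<lambda>ss. f (map snd ss)" k n c]
    block_Y_eq[of k n] block_Y_eq[of 0 n] by simp

lemma entropy_shift_block_Y: "\<H>(block (\<lambda>i. Y (i + k)) n) = \<H>(block Y n)"
  using markov_chain_entropy_shift[OF joint_chain joint_invariant, of "map snd" k n]
    block_Y_eq[of k n] block_Y_eq[of 0 n] by simp

lemma entropy_shift_joint: "\<H>(\<lambda>\<omega>. f (joint k \<omega>)) = \<H>(\<lambda>\<omega>. f (joint 0 \<omega>))"
  using markov_chain_entropy_shift[OF joint_chain joint_invariant, of "\<lambda>ss. f (ss ! 0)" k 1] by simp

lemma entropy_shift_joint2:
  "\<H>(\<lambda>\<omega>. f (joint k \<omega>) (joint (Suc k) \<omega>)) = \<H>(\<lambda>\<omega>. f (joint 0 \<omega>) (joint 1 \<omega>))"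
  using markov_chain_entropy_shift[OF joint_chain joint_invariant,
      of "\<lambda>ss. f (ss ! 0) (ss ! 1)" k 2] by simp

lemma entropy_shift_X: "\<H>(X k) = \<H>(X 0)"
  using entropy_shift_joint[of fst k] by (simp add: joint_def)

lemma entropy_shift_Y: "\<H>(Y k) = \<H>(Y 0)"
  using entropy_shift_joint[of snd k] by (simp add: joint_def)

lemma entropy_shift_XX: "\<H>(\<lambda>\<omega>. (X (Suc k) \<omega>, X k \<omega>)) = \<H>(\<lambda>\<omega>. (X 1 \<omega>, X 0 \<omega>))"
  using entropy_shift_joint2[of "\<lambda>s s'. (fst s', fst s)" k] by (simp add: joint_def)

lemma entropy_shift_YY: "\<H>(\<lambda>\<omega>. (Y k \<omega>, Y (Suc k) \<omega>)) = \<H>(\<lambda>\<omega>. (Y 0 \<omega>, Y 1 \<omega>))"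
  using entropy_shift_joint2[of "\<lambda>s s'. (snd s, snd s')" k] by (simp add: joint_def)

lemma entropy_shift_YX: "\<H>(\<lambda>\<omega>. (Y (Suc k) \<omega>, X k \<omega>)) = \<H>(\<lambda>\<omega>. (Y 1 \<omega>, X 0 \<omega>))"
  using entropy_shift_joint2[of "\<lambda>s s'. (snd s', fst s)" k] by (simp add: joint_def)

lemma joint_past_future:
  "\<I>((\<lambda>\<omega>. f (block joint (Suc n) \<omega>)) ; (\<lambda>\<omega>. g (joint (Suc n) \<omega>)) | X n) = 0"
proof -
  have "\<I>(block joint (Suc n) ; joint (Suc n) | (\<lambda>\<omega>. fst (joint n \<omega>))) = 0"
    by (rule markov_chain_past_future[OF joint_chain,
          where \<kappa> = "\<lambda>x (x', y'). P x x' * W x' y'"]) auto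
  moreover have "simple_function M (joint k)" for k
    by (rule markov_chain_simple_function[OF joint_chain])
  ultimately show ?thesis
    using conditional_mutual_information_image_eq_0[OF simple_function_block, of joint "joint (Suc n)" "X n" "Suc n" f g]
    by (simp add: joint_def)
qed

lemma X_past_future: "\<I>(block X (Suc n) ; X (Suc n) | X n) = 0"
proof -
  have "block X (Suc n) = (\<lambda>\<omega>. map fst (block joint (Suc n) \<omega>))"
    by (rule ext) (simp add: block_def joint_def)
  then show ?thesis using joint_past_future[of "map fst" n fst] by (simp add: joint_def)
qed

lemma Y_past_future: "\<I>(block Y (Suc n) ; Y (Suc n) | X n) = 0"
proof -
  have "block Y (Suc n) = (\<lambda>\<omega>. map snd (block joint (Suc n) \<omega>))"
    by (rule ext) (simp add: block_def joint_def)
  then show ?thesis using joint_past_future[of "map snd" n snd] by (simp add: joint_def)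
qed

lemma initial_observation_future: "\<I>(Y 0 ; (\<lambda>\<omega>. (X 1 \<omega>, Y 1 \<omega>)) | X 0) = 0"
  using joint_past_future[of "\<lambda>ss. snd (ss ! 0)" 0 "\<lambda>s. s"] by (simp add: joint_def)

text \<open>Here the conditioning is on the later state, so the separation of past and future does
  not apply. Instead the two-step path formula factors: the channel entry \<open>W x y\<close> does
  not involve the earlier pair \<open>s\<close>.\<close>

lemma observation_past: "\<I>((\<lambda>\<omega>. f (joint 0 \<omega>)) ; Y 1 | X 1) = 0"
proof -
  have sf: "simple_function M (joint k)" for k
    by (rule markov_chain_simple_function[OF joint_chain])
  have "\<I>(joint 0 ; Y 1 | X 1) = 0"
  proof (rule conditional_mutual_information_eq_0I)
    fix s y x
    have "\<P>(\<omega> in M. joint 0 \<omega> = s \<and> Y 1 \<omega> = y \<and> X 1 \<omega> = x) =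
        \<P>(\<omega> in M. \<forall>i\<le>1. joint i \<omega> = (if i = 0 then s else (x, y)))"
      by (intro arg_cong[where f = prob] Collect_cong) (auto simp: le_Suc_eq joint_def)
    also have "\<dots> = joint_init s * P (fst s) x * W x y"
      unfolding markov_chain_path[OF joint_chain] by (simp add: case_prod_beta)
    finally show "\<P>(\<omega> in M. joint 0 \<omega> = s \<and> Y 1 \<omega> = y \<and> X 1 \<omega> = x) =
        joint_init s * P (fst s) x * W x y" .
  qed (use sf in auto)
  then show ?thesis
    using conditional_mutual_information_image_eq_0[OF sf, of "Y 1" "X 1" 0 f "\<lambda>y. y"] by simp
qed

section \<open>Entropy rate and redundancy rates\<close>

text \<open>This is the conditional entropy of \<open>Y n\<close> given
  \<open>Y 0, ..., Y (n - 1)\<close>. As a difference of block entropies it telescopes, which the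
  divergence rate exploits.\<close>

definition block_increment :: "nat \<Rightarrow> real" where
  "block_increment n = \<H>(block Y (Suc n)) - \<H>(block Y n)"

lemma entropy_block_0: "\<H>(block Y 0) = 0"
proof -
  have "\<H>(block Y 0) = - expectation (\<lambda>\<omega>. log b (\<P>(\<omega>' in M. block Y 0 \<omega>' = block Y 0 \<omega>)))"
    by (rule entropy_eq_expectation) simp
  also have "\<dots> = 0" by (simp add: prob_space)
  finally show ?thesis .
qed

lemma sum_block_increment: "(\<Sum>i<n. block_increment i) = \<H>(block Y n)"
  by (induction n) (simp_all add: block_increment_def entropy_block_0 del: block_0)

lemma entropy_block_1: "\<H>(block Y 1) = \<H>(Y 0)"
  by (rule entropy_cong_bij[where f = hd and g = "\<lambda>y. [y]"]) (simp_all add: block_def)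

lemma entropy_block_2: "\<H>(block Y 2) = \<H>(\<lambda>\<omega>. (Y 0 \<omega>, Y 1 \<omega>))"
  by (rule entropy_cong_bij[where f = "\<lambda>ys. (ys ! 0, ys ! 1)" and g = "\<lambda>(y, y'). [y, y']"])
     (simp_all add: block_def upt_rec)

lemma block_increment_1: "block_increment 1 = \<H>(Y 1 | Y 0)"
  using entropy_block_1 entropy_block_2 entropy_chain_rule[of "Y 0" "Y 1"]
  by (simp add: block_increment_def numeral_2_eq_2)

lemma entropy_snoc:
  assumes "\<And>n. simple_function M (Z n)"
  shows "\<H>(block Z (Suc n)) = \<H>(\<lambda>\<omega>. (Z n \<omega>, block Z n \<omega>))"
  using assms
  by (intro entropy_cong_bij[where f = "\<lambda>zs. (last zs, butlast zs)" and g = "\<lambda>(z, zs). zs @ [z]"]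
      simple_function_block) (auto simp: block_Suc)

text \<open>By stationarity the increment at \<open>n\<close> is the entropy of Y_{n+1} given the
  middle block Y_1, ..., Y_n. Adding Y_0 to the condition can only lower it and yields the increment
  at \<open>n + 1\<close>.\<close>

lemma decseq_block_increment: "decseq block_increment"
proof (rule decseq_SucI)
  fix n
  let ?C = "block (\<lambda>i. Y (Suc i)) n"
  have C: "simple_function M ?C" by (intro simple_function_block simple_function_Y)
  have shift: "\<H>(block (\<lambda>i. Y (Suc i)) m) = \<H>(block Y m)" for m
    using entropy_shift_block_Y[of 1 m] by simp
  have "\<H>(\<lambda>\<omega>. (Y 0 \<omega>, Y (Suc n) \<omega>, ?C \<omega>)) + \<H>(?C) \<le>
      \<H>(\<lambda>\<omega>. (Y 0 \<omega>, ?C \<omega>)) + \<H>(\<lambda>\<omega>. (Y (Suc n) \<omega>, ?C \<omega>))"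
    using C by (intro entropy_submodular) simp_all
  moreover have "\<H>(\<lambda>\<omega>. (Y 0 \<omega>, ?C \<omega>)) = \<H>(block Y (Suc n))"
    using C by (intro entropy_cong_bij[where f = "\<lambda>(y, ys). y # ys" and g = "\<lambda>ys. (hd ys, tl ys)"]
        simple_function_Pair) (simp_all add: block_Suc_Cons)
  moreover have "\<H>(\<lambda>\<omega>. (Y (Suc n) \<omega>, ?C \<omega>)) = \<H>(block Y (Suc n))"
    using entropy_snoc[of "\<lambda>i. Y (Suc i)" n] shift[of "Suc n"] by simp
  moreover have "\<H>(\<lambda>\<omega>. (Y 0 \<omega>, Y (Suc n) \<omega>, ?C \<omega>)) = \<H>(block Y (Suc (Suc n)))"
    using C by (intro entropy_cong_bij[where f = "\<lambda>(y, y', ys). y # ys @ [y']"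
          and g = "\<lambda>ys. (hd ys, last ys, butlast (tl ys))"]
        simple_function_Pair) (simp_all add: block_Suc_Cons[of Y] block_Suc[of "\<lambda>i. Y (Suc i)"])
  ultimately show "block_increment (Suc n) \<le> block_increment n"
    unfolding block_increment_def using shift[of n] by linarith
qed

text \<open>Adding the hidden state \<open>X m\<close> to the condition lowers the entropy of
  \<open>Y (Suc m)\<close>. Given \<open>X m\<close> the past observations carry nothing more, and
  stationarity moves what is left to time 0.\<close>

lemma block_increment_ge: "\<H>(Y 1 | X 0) \<le> block_increment n"
proof -
  have "\<H>(Y 1 | X 0) \<le> block_increment (Suc m)" for m
  proof -
    let ?A = "Y (Suc m)" and ?B = "block Y (Suc m)"
    have "\<H>(\<lambda>\<omega>. (?A \<omega>, X m \<omega>, ?B \<omega>)) + \<H>(?B) \<le> \<H>(\<lambda>\<omega>. (?A \<omega>, ?B \<omega>)) + \<H>(\<lambda>\<omega>. (X m \<omega>, ?B \<omega>))"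
      by (intro entropy_submodular) simp_all
    moreover have "\<H>(\<lambda>\<omega>. (?A \<omega>, X m \<omega>, ?B \<omega>)) = \<H>(\<lambda>\<omega>. (?B \<omega>, ?A \<omega>, X m \<omega>))"
      by (intro entropy_cong_bij[where f = "\<lambda>(a, c, d). (d, a, c)" and g = "\<lambda>(d, a, c). (a, c, d)"]
          simple_function_Pair) simp_all
    moreover have "\<H>(\<lambda>\<omega>. (X m \<omega>, ?B \<omega>)) = \<H>(\<lambda>\<omega>. (?B \<omega>, X m \<omega>))"
      by (intro entropy_swap) simp_all
    moreover have "\<H>(\<lambda>\<omega>. (?B \<omega>, ?A \<omega>, X m \<omega>)) + \<H>(X m) =
        \<H>(\<lambda>\<omega>. (?B \<omega>, X m \<omega>)) + \<H>(\<lambda>\<omega>. (?A \<omega>, X m \<omega>))"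
      using Y_past_future[of m] conditional_mutual_information_entropy[of ?B ?A "X m"] by simp
    ultimately show ?thesis
      using entropy_snoc[of Y "Suc m"] entropy_shift_YX[of m] entropy_shift_X[of m]
        conditional_entropy_entropy[of "Y 1" "X 0"]
      by (simp add: block_increment_def)
  qed
  \<comment> \<open>The increment at 0 has no preceding hidden state, so the bound is obtained at
    \<open>Suc n\<close> and carried down to \<open>n\<close> by monotonicity.\<close>
  from this[of n] show ?thesis
    using decseq_SucD[OF decseq_block_increment, of n] by linarith
qed

definition entropy_rate_Y :: real where
  "entropy_rate_Y = lim block_increment"

lemma block_increment_tendsto: "block_increment \<longlonglongrightarrow> entropy_rate_Y"
proof -
  obtain l where "block_increment \<longlonglongrightarrow> l"
    using decseq_convergent[OF decseq_block_increment, of "\<H>(Y 1 | X 0)"] block_increment_ge by blast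
  then show ?thesis unfolding entropy_rate_Y_def by (simp add: limI)
qed

lemma entropy_rate_Y_ge: "\<H>(Y 1 | X 0) \<le> entropy_rate_Y"
  using block_increment_tendsto block_increment_ge by (intro LIMSEQ_le_const) auto

lemma entropy_rate_Y_le: "entropy_rate_Y \<le> \<H>(Y 1 | Y 0)"
  using decseq_ge[OF decseq_block_increment block_increment_tendsto, of 1] block_increment_1 by simp

lemma redundancy_rate_Y: "redundancy_rate Y = \<H>(Y 0) - entropy_rate_Y"
proof -
  have "\<I>(Y n ; block Y n) = \<H>(Y 0) - block_increment n" for n
    using mutual_information_entropy[of "Y n" "block Y n"] entropy_snoc[of Y n] entropy_shift_Y[of n]
    by (simp add: block_increment_def)
  then show ?thesis
    unfolding redundancy_rate_def
    by (auto intro!: limI tendsto_diff tendsto_const block_increment_tendsto)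
qed

text \<open>Given its last letter, the rest of the past says nothing about the next state, so the
  sequence is constant from index 1 on.\<close>

lemma redundancy_rate_X: "redundancy_rate X = \<I>(X 0 ; X 1)"
proof -
  have "\<I>(X (Suc n) ; block X (Suc n)) = \<I>(X 0 ; X 1)" for n
  proof -
    let ?B = "block X (Suc n)"
    have "\<H>(\<lambda>\<omega>. (?B \<omega>, X (Suc n) \<omega>, X n \<omega>)) + \<H>(X n) =
        \<H>(\<lambda>\<omega>. (?B \<omega>, X n \<omega>)) + \<H>(\<lambda>\<omega>. (X (Suc n) \<omega>, X n \<omega>))"
      using X_past_future[of n] conditional_mutual_information_entropy[of ?B "X (Suc n)" "X n"] by simp
    moreover have "\<H>(?B) = \<H>(\<lambda>\<omega>. (?B \<omega>, X n \<omega>))"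
      by (rule entropy_cong_bij[OF simple_function_block_X, where f = "\<lambda>xs. (xs, last xs)" and g = fst])
         (simp_all add: block_Suc)
    moreover have "\<H>(\<lambda>\<omega>. (X (Suc n) \<omega>, ?B \<omega>)) = \<H>(\<lambda>\<omega>. (?B \<omega>, X (Suc n) \<omega>, X n \<omega>))"
      by (intro entropy_cong_bij[where f = "\<lambda>(x, xs). (xs, x, last xs)" and g = "\<lambda>(xs, x, x'). (x, xs)"]
          simple_function_Pair simple_function_X simple_function_block_X) (simp_all add: block_Suc)
    ultimately show ?thesis
      using mutual_information_entropy[of "X (Suc n)" ?B] mutual_information_entropy[of "X 0" "X 1"]
        entropy_shift_XX[of n] entropy_shift_X[of n] entropy_shift_X[of "Suc n"] entropy_shift_X[of 1]
        entropy_swap[of "X 0" "X 1"] by simp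
  qed
  \<comment> \<open>At index 0 the block is empty and the information is 0, hence the limit is taken
    along the shifted sequence.\<close>
  then have "(\<lambda>n. \<I>(X (Suc n) ; block X (Suc n))) \<longlonglongrightarrow> \<I>(X 0 ; X 1)" by simp
  then show ?thesis
    unfolding redundancy_rate_def by (intro limI) (rule LIMSEQ_imp_Suc)
qed

section \<open>Cost functions and reversibility\<close>

lemma cost_L_nonneg: "0 \<le> cost_L X Y"
  using entropy_rate_Y_ge entropy_rate_Y_le by (simp add: cost_L_def)

text \<open>The entropies containing \<open>Y 0\<close> combine to the marginal entropy of
  \<open>Y 1\<close>, leaving I(X_0;X_1) - I(X_0;Y_1). Since I(X_0;Y_1|X_1) = 0, the chain rule
  turns this into the claim.\<close>

lemma cost_P_minus_cost_L: "cost_P X Y - cost_L X Y = \<I>(X 0 ; X 1 | Y 1)"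
proof -
  have "\<I>(X 0 ; Y 1 | X 1) = 0" using observation_past[of fst] by (simp add: joint_def)
  moreover have "\<H>(\<lambda>\<omega>. (X 0 \<omega>, Y 1 \<omega>, X 1 \<omega>)) = \<H>(\<lambda>\<omega>. (X 0 \<omega>, X 1 \<omega>, Y 1 \<omega>))"
    by (intro entropy_cong_bij[where f = "\<lambda>(a, c, d). (a, d, c)" and g = "\<lambda>(a, c, d). (a, d, c)"]
        simple_function_Pair) simp_all
  ultimately show ?thesis
    using entropy_swap[of "Y 1" "X 1"] entropy_swap[of "Y 1" "X 0"] entropy_swap[of "Y 1" "Y 0"]
    by (simp add: cost_P_def cost_L_def mutual_information_entropy conditional_entropy_entropy
        conditional_mutual_information_entropy)
qed

text \<open>Time reversal replaces H(Y_1|X_0) by H(Y_0|X_1), and stationarity replaces H(Y_1|Y_0) by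
  H(Y_0|Y_1). As Y_1 adds nothing to X_1 about Y_0, the difference is I(Y_0;X_1|Y_1).\<close>

lemma cost_reversible:
  assumes "reversible \<mu> P"
  shows "cost_L X Y \<le> cost_P X Y - cost_L X Y"
proof -
  have sf: "simple_function M (\<lambda>\<omega>. (joint 0 \<omega>, joint 1 \<omega>))" "simple_function M (\<lambda>\<omega>. (joint 1 \<omega>, joint 0 \<omega>))"
    by (intro simple_function_Pair markov_chain_simple_function[OF joint_chain])+
  have law: "\<P>(\<omega> in M. (joint 0 \<omega>, joint 1 \<omega>) = (s, s')) = joint_init s * joint_kernel s s'" for s s'
  proof -
    have "\<P>(\<omega> in M. (joint 0 \<omega>, joint 1 \<omega>) = (s, s')) =
        \<P>(\<omega> in M. \<forall>i\<le>1. joint i \<omega> = (if i = 0 then s else s'))"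
      by (intro arg_cong[where f = prob] Collect_cong) (auto simp: le_Suc_eq)
    then show ?thesis unfolding markov_chain_path[OF joint_chain] by simp
  qed
  \<comment> \<open>Detailed balance lifts to the pair process because both channel entries occur on
    either side.\<close>
  have sym: "joint_init s * joint_kernel s s' = joint_init s' * joint_kernel s' s" for s s'
  proof -
    have "\<mu> (fst s) * P (fst s) (fst s') = \<mu> (fst s') * P (fst s') (fst s)"
      using assms unfolding reversible_def by simp
    then have "(\<mu> (fst s) * P (fst s) (fst s')) * (W (fst s) (snd s) * W (fst s') (snd s')) =
        (\<mu> (fst s') * P (fst s') (fst s)) * (W (fst s) (snd s) * W (fst s') (snd s'))"
      by simp
    then show ?thesis by (simp add: case_prod_beta mult_ac)
  qed
  have "\<P>(\<omega> in M. (joint 0 \<omega>, joint 1 \<omega>) = t) = \<P>(\<omega> in M. (joint 1 \<omega>, joint 0 \<omega>) = t)" for t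
    using law[of "fst t" "snd t"] law[of "snd t" "fst t"] sym[of "fst t" "snd t"]
    by (cases t) (simp add: conj_commute)
  \<comment> \<open>The same projection, hidden part of one entry and observed part of the other, is
    applied to the pair and to its reversal.\<close>
  from prob_image_cong[OF sf this, of "\<lambda>(s, s'). (fst s, snd s')"]
  have "\<H>(\<lambda>\<omega>. (X 0 \<omega>, Y 1 \<omega>)) = \<H>(\<lambda>\<omega>. (X 1 \<omega>, Y 0 \<omega>))"
    by (intro entropy_cong_law simple_function_Pair) (simp_all add: joint_def)
  then have rev: "\<H>(\<lambda>\<omega>. (Y 1 \<omega>, X 0 \<omega>)) = \<H>(\<lambda>\<omega>. (Y 0 \<omega>, X 1 \<omega>))"
    using entropy_swap[of "X 0" "Y 1"] entropy_swap[of "X 1" "Y 0"] by simp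
  have "\<I>(Y 0 ; Y 1 | X 1) = 0" using observation_past[of snd] by (simp add: joint_def)
  moreover have "\<H>(\<lambda>\<omega>. (Y 0 \<omega>, Y 1 \<omega>, X 1 \<omega>)) = \<H>(\<lambda>\<omega>. (Y 0 \<omega>, X 1 \<omega>, Y 1 \<omega>))"
    by (intro entropy_cong_bij[where f = "\<lambda>(a, c, d). (a, d, c)" and g = "\<lambda>(a, c, d). (a, d, c)"]
        simple_function_Pair) simp_all
  ultimately have "cost_L X Y = \<I>(Y 0 ; X 1 | Y 1)"
    using rev entropy_swap[of "Y 1" "X 1"] entropy_swap[of "Y 1" "Y 0"]
      entropy_shift_X[of 1] entropy_shift_Y[of 1]
    by (simp add: cost_L_def conditional_entropy_entropy conditional_mutual_information_entropy)
  also have "\<dots> \<le> \<I>((\<lambda>\<omega>. (X 0 \<omega>, Y 0 \<omega>)) ; X 1 | Y 1)"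
    using conditional_mutual_information_image_le[of "\<lambda>\<omega>. (X 0 \<omega>, Y 0 \<omega>)" "X 1" "Y 1" snd]
    by (simp add: simple_function_Pair)
  \<comment> \<open>The excess is I(Y_0;X_1|X_0,Y_1), which vanishes because given
    \<open>X 0\<close> the observation \<open>Y 0\<close> is independent of
    \<open>(X 1, Y 1)\<close>.\<close>
  also have "\<dots> = \<I>(X 0 ; X 1 | Y 1)"
  proof -
    have "\<I>(Y 0 ; (\<lambda>\<omega>. (X 1 \<omega>, Y 1 \<omega>)) | X 0) = 0" by (rule initial_observation_future)
    moreover from this have "\<I>(Y 0 ; Y 1 | X 0) = 0"
      using conditional_mutual_information_image_eq_0[of "Y 0" "\<lambda>\<omega>. (X 1 \<omega>, Y 1 \<omega>)" "X 0" "\<lambda>y. y" snd]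
      by (simp add: simple_function_Pair)
    moreover have "\<H>(\<lambda>\<omega>. ((X 0 \<omega>, Y 0 \<omega>), Y 1 \<omega>)) = \<H>(\<lambda>\<omega>. (Y 0 \<omega>, Y 1 \<omega>, X 0 \<omega>))"
      by (intro entropy_cong_bij[where f = "\<lambda>((a, c), d). (c, d, a)" and g = "\<lambda>(c, d, a). ((a, c), d)"]
          simple_function_Pair) simp_all
    moreover have "\<H>(\<lambda>\<omega>. ((X 0 \<omega>, Y 0 \<omega>), X 1 \<omega>, Y 1 \<omega>)) =
        \<H>(\<lambda>\<omega>. (Y 0 \<omega>, (X 1 \<omega>, Y 1 \<omega>), X 0 \<omega>))"
      by (intro entropy_cong_bij[where f = "\<lambda>((a, c), d, e). (c, (d, e), a)"
            and g = "\<lambda>(c, (d, e), a). ((a, c), d, e)"] simple_function_Pair) simp_all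
    moreover have "\<H>(\<lambda>\<omega>. ((X 1 \<omega>, Y 1 \<omega>), X 0 \<omega>)) = \<H>(\<lambda>\<omega>. (X 0 \<omega>, X 1 \<omega>, Y 1 \<omega>))"
      by (intro entropy_swap simple_function_Pair) simp_all
    moreover have "\<H>(\<lambda>\<omega>. (Y 1 \<omega>, X 0 \<omega>)) = \<H>(\<lambda>\<omega>. (X 0 \<omega>, Y 1 \<omega>))"
      by (intro entropy_swap) simp_all
    ultimately show ?thesis
      by (simp add: conditional_mutual_information_entropy simple_function_Pair)
  qed
  finally show ?thesis by (simp add: cost_P_minus_cost_L)
qed

section \<open>Divergence from the Markov approximation\<close>

text \<open>A word of length \<open>Suc n\<close> has one initial letter and \<open>n\<close>
  transitions. Under the stationary law of Y each transition contributes the same expected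
  log-probability, so the cross entropy is H(Y_0) + n H(Y_1|Y_0).\<close>

lemma kl_divergence_block:
  assumes N: "prob_space N" and Yt: "markov_approximation M Y N Yt"
  shows "(\<Sum>z\<in>{z. length z = Suc n}. \<P>(\<omega> in M. block Y (Suc n) \<omega> = z) *
      log b (\<P>(\<omega> in M. block Y (Suc n) \<omega> = z) / \<P>(\<omega> in N. block Yt (Suc n) \<omega> = z))) =
    \<H>(Y 0) + real n * \<H>(Y 1 | Y 0) - \<H>(block Y (Suc n))"
proof -
  interpret N: prob_space N by (rule N)
  define p where "p zs = \<P>(\<omega> in M. block Y (Suc n) \<omega> = zs)" for zs
  define p1 where "p1 y = \<P>(\<omega> in M. Y 0 \<omega> = y)" for y
  define p2 where "p2 y y' = \<P>(\<omega> in M. Y 0 \<omega> = y \<and> Y 1 \<omega> = y')" for y y'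
  define q where "q zs = \<P>(\<omega> in N. block Yt (Suc n) \<omega> = zs)" for zs
  have "N.markov_chain p1 (\<lambda>y y'. p2 y y' / p1 y) Yt"
    using Yt unfolding markov_approximation_def p1_def p2_def cond_prob_def by (simp add: conj_commute)
  then have q: "q zs = p1 (zs ! 0) * (\<Prod>i<n. p2 (zs ! i) (zs ! Suc i) / p1 (zs ! i))"
    if "length zs = Suc n" for zs
    unfolding q_def using that by (rule N.markov_chain_block)
  have law1: "\<P>(\<omega> in M. Y i \<omega> = y) = p1 y" for i y
    using law_shift_Y[of "\<lambda>ys. ys ! 0" i 1 y] by (simp add: p1_def)
  have law2: "\<P>(\<omega> in M. Y i \<omega> = y \<and> Y (Suc i) \<omega> = y') = p2 y y'" for i y y'
    using law_shift_Y[of "\<lambda>ys. (ys ! 0, ys ! 1)" i 2 "(y, y')"] by (simp add: p2_def)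
  have sf2: "simple_function M (\<lambda>\<omega>. (Y i \<omega>, Y (Suc i) \<omega>))" for i
    by (intro simple_function_Pair) simp_all
  have E1: "expectation (\<lambda>\<omega>. log b (p1 (Y i \<omega>))) = - \<H>(Y 0)" for i
    using entropy_eq_expectation[of "Y i"] entropy_shift_Y[of i] by (simp add: law1)
  have E2: "expectation (\<lambda>\<omega>. log b (p2 (Y i \<omega>) (Y (Suc i) \<omega>))) = - \<H>(\<lambda>\<omega>. (Y 0 \<omega>, Y 1 \<omega>))" for i
    using entropy_eq_expectation[OF sf2[of i]] entropy_shift_YY[of i] by (simp add: law2)
  have I1: "integrable M (\<lambda>\<omega>. log b (p1 (Y i \<omega>)))" for i
    by (rule integrable_of_simple_function) simp
  have I2: "integrable M (\<lambda>\<omega>. log b (p2 (Y i \<omega>) (Y (Suc i) \<omega>)))" for i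
    using integrable_of_simple_function[OF sf2[of i], of "\<lambda>(y, y'). log b (p2 y y')"] by simp
  have Ip: "integrable M (\<lambda>\<omega>. log b (p (block Y (Suc n) \<omega>)))"
    and Ir: "integrable M (\<lambda>\<omega>. log b (p (block Y (Suc n) \<omega>) / q (block Y (Suc n) \<omega>)))"
    using integrable_of_simple_function[OF simple_function_block_Y, of "\<lambda>zs. log b (p zs)"]
      integrable_of_simple_function[OF simple_function_block_Y, of "\<lambda>zs. log b (p zs / q zs)"] by blast+
  let ?r = "\<lambda>\<omega>. log b (p (block Y (Suc n) \<omega>)) - log b (p1 (Y 0 \<omega>)) -
      (\<Sum>i<n. log b (p2 (Y i \<omega>) (Y (Suc i) \<omega>)) - log b (p1 (Y i \<omega>)))"
  have "(\<Sum>z\<in>{z. length z = Suc n}. p z * log b (p z / q z)) =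
      expectation (\<lambda>\<omega>. log b (p (block Y (Suc n) \<omega>) / q (block Y (Suc n) \<omega>)))"
    using expectation_simple_function[OF simple_function_block_Y, of "{z. length z = Suc n}" "Suc n"
        "\<lambda>z. log b (p z / q z)"] finite_lists_length_eq[of "UNIV :: 'y set" "Suc n"]
    by (simp add: p_def image_subset_iff)
  also have "\<dots> = expectation ?r"
  proof (rule integral_cong_AE)
    \<comment> \<open>Along almost every path all letters and all transitions have positive
      probability. So \<open>q\<close> is positive as well, and neither the totalized quotient p2/p1
      nor a division by \<open>q\<close> at 0 affects the expectation.\<close>
    have "AE \<omega> in M. \<forall>i. 0 < p1 (Y i \<omega>)"
      unfolding AE_all_countable using AE_prob_fiber_pos[of "Y _"] by (simp add: law1)
    moreover have "AE \<omega> in M. \<forall>i. 0 < p2 (Y i \<omega>) (Y (Suc i) \<omega>)"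
      unfolding AE_all_countable using AE_prob_fiber_pos[OF sf2] by (simp add: law2)
    moreover have "AE \<omega> in M. 0 < p (block Y (Suc n) \<omega>)"
      unfolding p_def by (rule AE_prob_fiber_pos) simp
    ultimately show "AE \<omega> in M. log b (p (block Y (Suc n) \<omega>) / q (block Y (Suc n) \<omega>)) = ?r \<omega>"
    proof eventually_elim
      case (elim \<omega>)
      then have nz: "p1 (Y i \<omega>) \<noteq> 0" "p2 (Y i \<omega>) (Y (Suc i) \<omega>) \<noteq> 0" for i
        by (metis less_irrefl)+
      have "log b (\<Prod>i<m. p2 (Y i \<omega>) (Y (Suc i) \<omega>) / p1 (Y i \<omega>)) =
          (\<Sum>i<m. log b (p2 (Y i \<omega>) (Y (Suc i) \<omega>)) - log b (p1 (Y i \<omega>)))" for m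
      proof (induction m)
        case (Suc m)
        then show ?case by (simp add: log_mult log_divide nz)
      qed simp
      moreover have "q (block Y (Suc n) \<omega>) = p1 (Y 0 \<omega>) * (\<Prod>i<n. p2 (Y i \<omega>) (Y (Suc i) \<omega>) / p1 (Y i \<omega>))"
        by (subst q) auto
      ultimately show ?case using elim(3) by (simp add: log_mult log_divide nz)
    qed
  qed (intro borel_measurable_integrable Ir Bochner_Integration.integrable_diff
        Bochner_Integration.integrable_sum Ip I1 I2)+
  also have "\<dots> = \<H>(Y 0) + real n * \<H>(Y 1 | Y 0) - \<H>(block Y (Suc n))"
    using entropy_eq_expectation[OF simple_function_block_Y[of "Suc n"]]
      entropy_chain_rule[of "Y 0" "Y 1"]
    by (simp add: Ip I1 I2 E1 E2 p_def[symmetric] algebra_simps)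
  finally show ?thesis unfolding p_def q_def .
qed

text \<open>The block entropy is the sum of the increments, so after division by the word length it
  is their Cesaro mean and inherits their limit; the single initial letter is washed out.\<close>

lemma kl_divergence_rate_markov_approximation:
  assumes "prob_space N" "markov_approximation M Y N Yt"
  shows "kl_divergence_rate b M Y N Yt = \<H>(Y 1 | Y 0) - entropy_rate_Y"
  unfolding kl_divergence_rate_def
proof (rule limI, rule LIMSEQ_imp_Suc)
  let ?u = "\<lambda>n. (\<H>(Y 0) - \<H>(Y 1 | Y 0)) / real (Suc n) + \<H>(Y 1 | Y 0) -
      (\<Sum>i<Suc n. block_increment i) / real (Suc n)"
  have "?u \<longlonglongrightarrow> 0 + \<H>(Y 1 | Y 0) - entropy_rate_Y"
    by (intro tendsto_intros LIMSEQ_Suc[OF lim_const_over_n]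
        LIMSEQ_Suc[OF tendsto_arithmetic_mean[OF block_increment_tendsto]])
  moreover have "?u n = 1 / real (Suc n) *
      (\<H>(Y 0) + real n * \<H>(Y 1 | Y 0) - \<H>(block Y (Suc n)))" for n
  proof -
    \<comment> \<open>Here \<open>x\<close> is the word length and \<open>x - 1\<close> the number
      of transitions; the missing transition is the source of the term (a - c) / x.\<close>
    have "(a - c) / x + c - h / x = 1 / x * (a + (x - 1) * c - h)" if "x \<noteq> 0" for a c h x :: real
      using that by (simp add: field_simps)
    from this[of "real (Suc n)"] show ?thesis
      unfolding sum_block_increment by simp
  qed
  ultimately show "(\<lambda>n. 1 / real (Suc n) * (\<Sum>z\<in>{z. length z = Suc n}.
      \<P>(\<omega> in M. block Y (Suc n) \<omega> = z) * log b (\<P>(\<omega> in M. block Y (Suc n) \<omega> = z) /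
        \<P>(\<omega> in N. block Yt (Suc n) \<omega> = z)))) \<longlonglongrightarrow> \<H>(Y 1 | Y 0) - entropy_rate_Y"
    unfolding kl_divergence_block[OF assms] by simp
qed

lemma delta_eq:
  assumes "prob_space N" "markov_approximation M Y N Yt"
  shows "delta \<beta> X Y N Yt =
    (1 - 2 * \<beta>) * (\<H>(Y 1 | Y 0) - entropy_rate_Y) + \<beta> * cost_P X Y"
proof -
  have I: "\<I>(Y 0 ; Y 1) = \<H>(Y 0) - \<H>(Y 1 | Y 0)"
    using mutual_information_entropy[of "Y 0" "Y 1"] entropy_chain_rule[of "Y 0" "Y 1"]
      entropy_shift_Y[of 1] by simp
  show ?thesis
    unfolding delta_def kl_divergence_rate_markov_approximation[OF assms] redundancy_rate_X
      redundancy_rate_Y cost_P_def I by (simp add: algebra_simps)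
qed

lemma divergence_le_cost_L: "\<H>(Y 1 | Y 0) - entropy_rate_Y \<le> cost_L X Y"
  using entropy_rate_Y_ge by (simp add: cost_L_def)

end

theorem lemma4:
  fixes M :: "'w measure" and N :: "'v measure" and b :: real
    and P :: "'x::finite \<Rightarrow> 'x \<Rightarrow> real" and \<mu> :: "'x \<Rightarrow> real"
    and W :: "'x \<Rightarrow> 'y::finite \<Rightarrow> real"
    and X :: "nat \<Rightarrow> 'w \<Rightarrow> 'x" and Y :: "nat \<Rightarrow> 'w \<Rightarrow> 'y" and Yt :: "nat \<Rightarrow> 'v \<Rightarrow> 'y"
  assumes "information_space M b"
    and "prob_space N"
    and "row_stochastic P" and "irreducible_matrix P" and "aperiodic_matrix P"
    and "invariant_distribution \<mu> P"
    and "prob_space.markov_chain M \<mu> P X"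
    and "row_stochastic W"
    and "prob_space.observed_through M W X Y"
    and "markov_approximation M Y N Yt"
  shows "(\<forall>\<beta>\<in>{0..1}. 0 \<le> information_space.cost M b \<beta> X Y) \<and>
    (information_space.delta M b (1/2) X Y N Yt = information_space.cost M b (1/2) X Y \<and>
     information_space.cost M b (1/2) X Y = 1/2 * information_space.cost_P M b X Y) \<and>
    information_space.cost M b 1 X Y =
      information_space.conditional_mutual_information_Pow M b (X 0) (X 1) (Y 1) \<and>
    (\<forall>\<beta>\<in>{0..1}. \<beta> \<le> 1/2 \<longrightarrow>
       \<beta> * information_space.cost_P M b X Y \<le> information_space.delta M b \<beta> X Y N Yt \<and>
       information_space.delta M b \<beta> X Y N Yt \<le> information_space.cost M b \<beta> X Y) \<and>
    (\<forall>\<beta>\<in>{0..1}. 1/2 \<le> \<beta> \<longrightarrow>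
       information_space.cost M b \<beta> X Y \<le> information_space.delta M b \<beta> X Y N Yt \<and>
       information_space.delta M b \<beta> X Y N Yt \<le> \<beta> * information_space.cost_P M b X Y) \<and>
    (reversible \<mu> P \<longrightarrow> mono_on {0..1} (\<lambda>\<beta>. information_space.cost M b \<beta> X Y))"
proof -
  interpret information_space M b by (rule assms(1))
  interpret hidden_markov_chain M b P \<mu> W X Y
    using assms by unfold_locales
  let ?L = "cost_L X Y" and ?P = "cost_P X Y" and ?D = "\<H>(Y 1 | Y 0) - entropy_rate_Y"
  note delta = delta_eq[OF assms(2,10)]
  have L: "0 \<le> ?L" by (rule cost_L_nonneg)
  have D: "0 \<le> ?D" "?D \<le> ?L"
    using entropy_rate_Y_le divergence_le_cost_L by auto
  have PL: "0 \<le> ?P - ?L"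
    unfolding cost_P_minus_cost_L by (rule conditional_mutual_information_nonneg) simp_all
  have cost: "cost \<beta> X Y = (1 - \<beta>) * ?L + \<beta> * (?P - ?L)" for \<beta>
    by (simp add: cost_def algebra_simps)
  have "0 \<le> cost \<beta> X Y" if "\<beta> \<in> {0..1}" for \<beta>
    using that L PL unfolding cost by simp
  moreover have "delta (1/2) X Y N Yt = cost (1/2) X Y" "cost (1/2) X Y = 1/2 * ?P"
    unfolding delta cost_def by simp_all
  moreover have "cost 1 X Y = \<I>(X 0 ; X 1 | Y 1)"
    unfolding cost cost_P_minus_cost_L[symmetric] by simp
  \<comment> \<open>\<open>delta\<close> and \<open>cost\<close> are \<open>\<beta> * ?P\<close>
    plus \<open>1 - 2 * \<beta>\<close> times \<open>?D\<close> and \<open>?L\<close> respectively.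
    The sign of this factor changes at 1/2 and reverses the order of the three quantities.\<close>
  moreover have "\<beta> * ?P \<le> delta \<beta> X Y N Yt \<and> delta \<beta> X Y N Yt \<le> cost \<beta> X Y"
    if "\<beta> \<le> 1/2" for \<beta>
    using that D mult_left_mono[OF D(2), of "1 - 2 * \<beta>"] unfolding delta cost_def by simp
  moreover have "cost \<beta> X Y \<le> delta \<beta> X Y N Yt \<and> delta \<beta> X Y N Yt \<le> \<beta> * ?P"
    if "1/2 \<le> \<beta>" for \<beta>
    using that D mult_left_mono_neg[OF D(2), of "1 - 2 * \<beta>"] unfolding delta cost_def
    by (simp add: mult_nonpos_nonneg)
  moreover have "mono_on {0..1} (\<lambda>\<beta>. cost \<beta> X Y)" if "reversible \<mu> P"
  proof (rule mono_onI)
    fix r s :: real assume "r \<le> s"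
    \<comment> \<open>\<open>?P - ?L - ?L\<close> is the slope of \<open>cost\<close> in its
      parameter.\<close>
    then have "r * (?P - ?L - ?L) \<le> s * (?P - ?L - ?L)"
      using cost_reversible[OF that] by (intro mult_right_mono) auto
    then show "cost r X Y \<le> cost s X Y" by (simp add: cost algebra_simps)
  qed
  ultimately show ?thesis by blast
qed

end
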